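(* Assume A1, A2, A3 (stated in the context) for the LP given by $(\mathbf{A},\mathbf{b},\mathbf{c})$. Run the online algorithm with variable duplication with $K$ duplications, where $K=\mathcal{O}(n)$, with constant stepsize $\gamma=\mathcal{O}(1/\sqrt{Kmn})$ (meaning: $\gamma$ is of order $1/\sqrt{Kmn}$). Then, both for the explicit subgradient update and for the implicit proximal point update, the output $\hat{\mathbf{x}}$ satisfies $$\mathbb{E}[\rho(\hat{\mathbf{x}})]\le\mathcal{O}\Big(\frac{m\log n}{K}+\sqrt{\frac nK}\,\log n+\sqrt{\frac{mn}{K}}\Big),\qquad \mathbb{E}[v(\hat{\mathbf{x}})]\le\mathcal{O}\Big(\frac mK+\sqrt{\frac{mn}{K}}\Big),$$ where $\mathbb{E}[\cdot]$ is taken over the random permutation of the $nK$ columns.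
   Context: LP setting. Let $\mathbf{A}\in\mathbb{R}^{m\times n}$ with columns $\mathbf{a}_1,\dots,\mathbf{a}_n$, $\mathbf{b}\in\mathbb{R}^m$, $\mathbf{c}\in\mathbb{R}^n$. The LP is $\max\{\langle\mathbf{c},\mathbf{x}\rangle:\mathbf{x}\in\mathcal{F}_p\}$ with $\mathcal{F}_p=\{\mathbf{x}\in\mathbb{R}^n:\mathbf{A}\mathbf{x}\le\mathbf{b},\ \mathbf{0}\le\mathbf{x}\le\mathbf{1}\}$. Put $\mathbf{d}=\mathbf{b}/n$. $\|\cdot\|$ is the Euclidean norm, $[\cdot]_+$ the elementwise positive part, $\mathbb{I}\{\cdot\}$ the 0-1 indicator. Assumptions. A1: $\max_i d_i=\bar d\ge\min_i d_i=\underline d>0$. A2: there are constants $\bar a,\bar c>0$ with $\|\mathbf{a}_j\|_\infty\le\bar a$ and $|c_j|\le\bar c$ for all $j\in\{1,\dots,n\}$. A3: for every $\mathbf{y}\in\mathbb{R}^m$ with $\mathbf{y}\ge\mathbf{0}$, at most $m$ indices $j$ satisfy $c_j=\langle\mathbf{a}_j,\mathbf{y}\rangle$. Algorithm with duplication ($K\ge1$ integer, constant stepsize $\gamma>0$). Make $K$ copies of each column $(c_j,\mathbf{a}_j)$, obtaining the LP with $nK$ variables $\max\{\sum_{l=1}^K\langle\mathbf{c},\mathbf{x}_l\rangle:\sum_{l=1}^K\mathbf{A}\mathbf{x}_l\le K\mathbf{b},\ \mathbf{0}\le\mathbf{x}_l\le\mathbf{1}\}$ (whose vector "right-hand side over number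 of variables" is again $\mathbf{d}=\mathbf{b}/n$). Order the $nK$ columns by a uniformly random permutation and denote the $k$-th processed column by $(c_k,\mathbf{a}_k)$. The initial dual point $\mathbf{y}^1\in\mathbb{R}^m$ is an input of the algorithm. For $k=1,\dots,nK$ perform one of the following (the same type throughout). - Explicit subgradient update: $x^k=\mathbb{I}\{c_k>\langle\mathbf{a}_k,\mathbf{y}^k\rangle\}$ and $\mathbf{y}^{k+1}=[\mathbf{y}^k-\gamma(\mathbf{d}-\mathbf{a}_kx^k)]_+$. - Implicit proximal point update: solve $\min_{\mathbf{y},s}\{\langle\mathbf{d},\mathbf{y}\rangle+s+\frac1{2\gamma}\|\mathbf{y}-\mathbf{y}^k\|^2:\mathbf{y}\ge\mathbf{0},\ s\ge c_k-\langle\mathbf{a}_k,\mathbf{y}\rangle,\ s\ge0\}$; $\mathbf{y}^{k+1}$ is the optimal $\mathbf{y}$ and $x^k$ is the Lagrange (KKT) multiplier of $s\ge c_k-\langle\mathbf{a}_k,\mathbf{y}\rangle$ at the optimum. Collect the values $x^k$ into $\hat{\mathbf{x}}_1,\dots,\hat{\mathbf{x}}_K\in\mathbb{R}^n$, where the $j$-th entry of $\hat{\mathbf{x}}_l$ is the value assigned to the $l$-th copy of column $j$. The output is $\hat{\mathbf{x}}=\frac1K\sum_{l=1}^K\hat{\mathbf{x}}_l$. Performance measures, with respect to the original LP: optimality gap $\rho(\hat{\mathbf{x}})=\max_{\mathbf{x}\in\mathcal{F}_p}\langle\mathbf{c},\mathbf{x}\rangle-\langle\mathbf{c},\hat{\mathbf{x}}\rangle$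 and constraint violation $v(\hat{\mathbf{x}})=\|[\mathbf{A}\hat{\mathbf{x}}-\mathbf{b}]_+\|$. Conventions: "$\gamma$ of order $1/\sqrt{Kmn}$" means $\kappa_1/\sqrt{Kmn}\le\gamma\le\kappa_2/\sqrt{Kmn}$ for fixed constants $\kappa_1,\kappa_2>0$; $K=\mathcal{O}(n)$ means $K\le\kappa_3 n$ for a fixed constant $\kappa_3$. The constants implied by $\mathcal{O}(\cdot)$ in the conclusion may depend on $\bar a,\bar c,\underline d,\bar d,\kappa_1,\kappa_2,\kappa_3$ but not on $m,n,K$ ($n\ge2$).
   Formalization: The initial dual point y^1 is assumed to satisfy ||y^1|| ≤ R, and the constants in O(·) may also depend on R; uniformly over all y^1 the bounds fail (a huge y^1 makes every explicit x^k zero, so the gap is of order n). *)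

theory Defs
  imports "HOL-Probability.Probability" "Jordan_Normal_Form.Matrix"
begin

hide_type (open) Finite_Cartesian_Product.vec
hide_const (open) Finite_Cartesian_Product.vec
no_notation inner (infix "\<bullet>" 70)
no_notation Finite_Cartesian_Product.vec_nth (infixl "$" 90)

definition l2norm :: "real vec \<Rightarrow> real" where
  "l2norm v = L2_set (\<lambda>i. v $ i) {..<dim_vec v}"

definition pos_part :: "real vec \<Rightarrow> real vec" where
  "pos_part v = map_vec (\<lambda>t. max 0 t) v"

definition feasible :: "real mat \<Rightarrow> real vec \<Rightarrow> real vec set" where
  "feasible A b = {x \<in> carrier_vec (dim_col A).
     A *\<^sub>v x \<le> b \<and> (\<forall>j<dim_col A. 0 \<le> x $ j \<and> x $ j \<le> 1)}"

text \<open>The feasible set is compact, and it contains the origin when \<open>b \<ge> 0\<close>, so the supremum is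
  then an attained maximum.\<close>

definition opt_gap :: "real mat \<Rightarrow> real vec \<Rightarrow> real vec \<Rightarrow> real vec \<Rightarrow> real" where
  "opt_gap A b c xh = (SUP x\<in>feasible A b. c \<bullet> x) - c \<bullet> xh"

definition violation :: "real mat \<Rightarrow> real vec \<Rightarrow> real vec \<Rightarrow> real" where
  "violation A b xh = l2norm (pos_part (A *\<^sub>v xh - b))"

definition scaled_rhs :: "nat \<Rightarrow> real vec \<Rightarrow> real vec" where
  "scaled_rhs n b = (1 / real n) \<cdot>\<^sub>v b"

definition assm_A1 :: "nat \<Rightarrow> nat \<Rightarrow> real vec \<Rightarrow> real \<Rightarrow> real \<Rightarrow> bool" where
  "assm_A1 m n b dlow dbar \<longleftrightarrow>
     Max ((\<lambda>i. scaled_rhs n b $ i) ` {..<m}) = dbar \<and>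
     Min ((\<lambda>i. scaled_rhs n b $ i) ` {..<m}) = dlow \<and> dlow > 0"

definition assm_A2 :: "nat \<Rightarrow> nat \<Rightarrow> real mat \<Rightarrow> real vec \<Rightarrow> real \<Rightarrow> real \<Rightarrow> bool" where
  "assm_A2 m n A c abar cbar \<longleftrightarrow> abar > 0 \<and> cbar > 0 \<and>
     (\<forall>j<n. (\<forall>i<m. \<bar>col A j $ i\<bar> \<le> abar) \<and> \<bar>c $ j\<bar> \<le> cbar)"

definition assm_A3 :: "nat \<Rightarrow> nat \<Rightarrow> real mat \<Rightarrow> real vec \<Rightarrow> bool" where
  "assm_A3 m n A c \<longleftrightarrow>
     (\<forall>y\<in>carrier_vec m. 0\<^sub>v m \<le> y \<longrightarrow> card {j. j < n \<and> c $ j = col A j \<bullet> y} \<le> m)"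

text \<open>In the two step relations, \<open>ck\<close> and \<open>ak\<close> are the cost and the column being processed, \<open>y\<close> is
  the current dual point, \<open>xk\<close> the primal value produced and \<open>y'\<close> the next dual point.\<close>

definition explicit_step ::
  "real vec \<Rightarrow> real \<Rightarrow> real \<Rightarrow> real vec \<Rightarrow> real vec \<Rightarrow> real \<Rightarrow> real vec \<Rightarrow> bool" where
  "explicit_step d \<gamma> ck ak y xk y' \<longleftrightarrow>
     xk = (if ck > ak \<bullet> y then 1 else 0) \<and>
     y' = pos_part (y - \<gamma> \<cdot>\<^sub>v (d - xk \<cdot>\<^sub>v ak))"

definition prox_obj :: "real vec \<Rightarrow> real \<Rightarrow> real vec \<Rightarrow> real vec \<times> real \<Rightarrow> real" where
  "prox_obj d \<gamma> y = (\<lambda>(u, s). d \<bullet> u + s + 1 / (2 * \<gamma>) * (l2norm (u - y))\<^sup>2)"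

definition prox_feasible :: "nat \<Rightarrow> real \<Rightarrow> real vec \<Rightarrow> real vec \<times> real \<Rightarrow> bool" where
  "prox_feasible m ck ak = (\<lambda>(u, s).
     u \<in> carrier_vec m \<and> 0\<^sub>v m \<le> u \<and> s \<ge> ck - ak \<bullet> u \<and> s \<ge> 0)"

text \<open>KKT system of the proximal problem at \<open>(u, s)\<close>: the multipliers of the constraints \<open>u \<ge> 0\<close>,
  \<open>s \<ge> ck - ak \<bullet> u\<close> and \<open>s \<ge> 0\<close> are \<open>z\<close>, \<open>xk\<close> and \<open>w\<close>; the two equations are stationarity
  of the Lagrangian in \<open>u\<close> and in \<open>s\<close>. Primal feasibility is stated separately.\<close>

definition prox_multiplier ::
  "real vec \<Rightarrow> real \<Rightarrow> real \<Rightarrow> real vec \<Rightarrow> real vec \<Rightarrow> real vec \<Rightarrow> real \<Rightarrow> real \<Rightarrow> bool" where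
  "prox_multiplier d \<gamma> ck ak y u s xk \<longleftrightarrow>
     (\<exists>z\<in>carrier_vec (dim_vec d). \<exists>w.
        d + (1 / \<gamma>) \<cdot>\<^sub>v (u - y) - xk \<cdot>\<^sub>v ak - z = 0\<^sub>v (dim_vec d) \<and>
        1 - xk - w = 0 \<and>
        0\<^sub>v (dim_vec d) \<le> z \<and> 0 \<le> xk \<and> 0 \<le> w \<and>
        z \<bullet> u = 0 \<and> xk * (s - (ck - ak \<bullet> u)) = 0 \<and> w * s = 0)"

text \<open>The multiplier \<open>xk\<close> need not be unique (for instance if \<open>ck = 0\<close> and \<open>ak = 0\<close>), so the
  step is a relation that admits every valid multiplier.\<close>

definition implicit_step ::
  "real vec \<Rightarrow> real \<Rightarrow> real \<Rightarrow> real vec \<Rightarrow> real vec \<Rightarrow> real \<Rightarrow> real vec \<Rightarrow> bool" where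
  "implicit_step d \<gamma> ck ak y xk y' \<longleftrightarrow>
     (\<exists>s. is_arg_min (prox_obj d \<gamma> y) (prox_feasible (dim_vec d) ck ak) (y', s) \<and>
          prox_multiplier d \<gamma> ck ak y y' s xk)"

datatype update = Explicit | Implicit

fun dual_step ::
  "update \<Rightarrow> real vec \<Rightarrow> real \<Rightarrow> real \<Rightarrow> real vec \<Rightarrow> real vec \<Rightarrow> real \<Rightarrow> real vec \<Rightarrow> bool" where
  "dual_step Explicit = explicit_step"
| "dual_step Implicit = implicit_step"

text \<open>The pair \<open>(j, l)\<close> stands for the \<open>l\<close>-th copy of column \<open>j\<close>; a processing order lists each of
  the \<open>n * K\<close> pairs exactly once. Both columns and steps are numbered from \<open>0\<close>.\<close>

definition orders :: "nat \<Rightarrow> nat \<Rightarrow> (nat \<times> nat) list set" where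
  "orders n K = permutations_of_set ({..<n} \<times> {..<K})"

text \<open>\<open>Y k\<close> is the dual point before step \<open>k\<close>, and \<open>X (j, l)\<close> is the primal value assigned to the
  \<open>l\<close>-th copy of column \<open>j\<close>. The right-hand side per variable of the duplicated problem,
  \<open>K b / (n K)\<close>, is that of the original one.\<close>

definition dup_output ::
  "update \<Rightarrow> real mat \<Rightarrow> real vec \<Rightarrow> real vec \<Rightarrow> nat \<Rightarrow> real \<Rightarrow> real vec
    \<Rightarrow> (nat \<times> nat) list \<Rightarrow> real vec \<Rightarrow> bool" where
  "dup_output upd A b c K \<gamma> y1 ord xh \<longleftrightarrow>
     (\<exists>Y X. Y 0 = y1 \<and>
        (\<forall>k<dim_col A * K.
           dual_step upd (scaled_rhs (dim_col A) b) \<gamma>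
             (c $ fst (ord ! k)) (col A (fst (ord ! k)))
             (Y k) (X (ord ! k)) (Y (Suc k))) \<and>
        xh = vec (dim_col A) (\<lambda>j. 1 / real K * (\<Sum>l<K. X (j, l))))"

abbreviation order_expectation ::
  "nat \<Rightarrow> nat \<Rightarrow> ((nat \<times> nat) list \<Rightarrow> real) \<Rightarrow> real" where
  "order_expectation n K \<equiv> measure_pmf.expectation (pmf_of_set (orders n K))"

end

theory Submission
  imports Defs
begin

text \<open>For a feasible \<open>t\<close> put \<open>W k = \<langle>y k, d - a k * t k\<rangle>\<close>. Since \<open>x k\<close> nearly maximises
  \<open>u * (c k - \<langle>a k, y k\<rangle>)\<close> over \<open>u \<in> [0, 1]\<close>, the regret \<open>c k * (t k - x k)\<close> is at most
  \<open>\<langle>y k, d - a k * x k\<rangle> - W k\<close> up to an error of order \<open>\<gamma> m\<close>, and the first term telescopes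
  through \<open>\<parallel>y k\<parallel>\<^sup>2\<close>. The point \<open>y k\<close> depends only on the columns seen so far, so in expectation
  \<open>a k * t k\<close> may be replaced by its average over the \<open>N - k\<close> columns still to come. This average
  deviates from the overall mean, which is at most \<open>d\<close>, by \<open>O(sqrt (m / (N - k)))\<close> in mean square,
  because sampling without replacement has nonpositive covariances; summing over \<open>k\<close> costs
  \<open>O(\<parallel>y\<parallel> * sqrt (m N))\<close>. The drift \<open>- \<gamma> \<langle>d, y\<rangle>\<close> keeps \<open>\<parallel>y k\<parallel>\<close> of order \<open>1 + \<gamma> m\<close>,
  and the constraint violation is controlled by \<open>\<parallel>y\<parallel> / (\<gamma> K)\<close>.\<close>

section \<open>Exchanging positions in a uniformly random order\<close>

text \<open>Positions are exchanged rather than values, so a prefix that contains neither position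
  stays intact. For \<open>i = j\<close> this is the identity.\<close>

definition swap_at :: "nat \<Rightarrow> nat \<Rightarrow> 'a list \<Rightarrow> 'a list" where
  "swap_at i j xs = xs[i := xs ! j, j := xs ! i]"

lemma length_permutations_of_set: "xs \<in> permutations_of_set S \<Longrightarrow> length xs = card S"
  by (auto simp: permutations_of_set_def distinct_card)

lemma nth_swap_at:
  assumes "i < length xs" "j < length xs" "k < length xs"
  shows "swap_at i j xs ! k = (if k = i then xs ! j else if k = j then xs ! i else xs ! k)"
  using assms by (auto simp: swap_at_def nth_list_update)

lemma length_swap_at [simp]: "length (swap_at i j xs) = length xs"
  by (simp add: swap_at_def)

lemma swap_at_permutation:
  assumes "xs \<in> permutations_of_set S" "i < card S" "j < card S"
  shows "swap_at i j xs \<in> permutations_of_set S"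
proof -
  have l: "length xs = card S"
    using assms(1) by (rule length_permutations_of_set)
  have "mset (swap_at i j xs) = mset xs"
    unfolding swap_at_def using assms l by (intro mset_swap) auto
  then have "set (swap_at i j xs) = set xs" "distinct (swap_at i j xs) = distinct xs"
    by (rule mset_eq_setD, rule mset_eq_imp_distinct_iff)
  then show ?thesis
    using assms(1) by (simp add: permutations_of_set_def)
qed

lemma swap_at_swap_at:
  assumes "i < length xs" "j < length xs"
  shows "swap_at i j (swap_at i j xs) = xs"
  by (rule nth_equalityI) (use assms in \<open>auto simp: nth_swap_at\<close>)

text \<open>Exchangeability of the positions: \<open>swap_at i j\<close> is an involution on the
  orders, so it merely reindexes the sum.\<close>

lemma sum_permutations_swap_at:
  assumes "i < card S" "j < card S"
  shows "(\<Sum>xs\<in>permutations_of_set S. F (swap_at i j xs)) = (\<Sum>xs\<in>permutations_of_set S. F xs)"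
  by (rule sum.reindex_bij_witness[where i = "swap_at i j" and j = "swap_at i j"])
     (use assms in \<open>auto simp: swap_at_permutation swap_at_swap_at length_permutations_of_set\<close>)

lemma sum_nth_permutation:
  assumes "xs \<in> permutations_of_set S"
  shows "(\<Sum>k<card S. g (xs ! k)) = (\<Sum>j\<in>S. g j)"
proof -
  have "bij_betw ((!) xs) {..<card S} S"
    using assms by (intro bij_betw_nth)
      (auto simp: permutations_of_set_def distinct_card)
  then show ?thesis by (rule sum.reindex_bij_betw)
qed

text \<open>A quantity determined by the first \<open>k\<close> entries cannot tell position \<open>k\<close> from a later one.\<close>

lemma sum_past_times_next:
  fixes H :: "'a list \<Rightarrow> real" and g :: "'a \<Rightarrow> real"
  assumes past: "\<And>xs ys. xs \<in> permutations_of_set S \<Longrightarrow> ys \<in> permutations_of_set S \<Longrightarrow>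
      take k xs = take k ys \<Longrightarrow> H xs = H ys"
    and k: "k < card S"
  shows "real (card S - k) * (\<Sum>xs\<in>permutations_of_set S. H xs * g (xs ! k))
    = (\<Sum>xs\<in>permutations_of_set S. H xs * (\<Sum>i\<in>{k..<card S}. g (xs ! i)))"
proof -
  let ?P = "permutations_of_set S"
  have eq: "(\<Sum>xs\<in>?P. H xs * g (xs ! i)) = (\<Sum>xs\<in>?P. H xs * g (xs ! k))"
    if i: "i \<in> {k..<card S}" for i
  proof -
    have "(\<Sum>xs\<in>?P. H xs * g (xs ! i)) =
        (\<Sum>xs\<in>?P. H (swap_at k i xs) * g (swap_at k i xs ! k))"
    proof (rule sum.cong[OF refl])
      fix xs assume xs: "xs \<in> ?P"
      have l: "length xs = card S" using xs by (rule length_permutations_of_set)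
      have "take k (swap_at k i xs) = take k xs"
        by (rule nth_equalityI) (use i k l in \<open>auto simp: nth_swap_at\<close>)
      then have "H (swap_at k i xs) = H xs"
        using i by (intro past swap_at_permutation xs k) auto
      moreover have "swap_at k i xs ! k = xs ! i"
        using i k l by (simp add: nth_swap_at)
      ultimately show "H xs * g (xs ! i) = H (swap_at k i xs) * g (swap_at k i xs ! k)" by simp
    qed
    also have "\<dots> = (\<Sum>xs\<in>?P. H xs * g (xs ! k))"
      using i k by (intro sum_permutations_swap_at[where F = "\<lambda>xs. H xs * g (xs ! k)"]) auto
    finally show ?thesis .
  qed
  have "real (card S - k) * (\<Sum>xs\<in>?P. H xs * g (xs ! k))
      = (\<Sum>i\<in>{k..<card S}. \<Sum>xs\<in>?P. H xs * g (xs ! k))"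
    by simp
  also have "\<dots> = (\<Sum>i\<in>{k..<card S}. \<Sum>xs\<in>?P. H xs * g (xs ! i))"
    by (rule sum.cong[OF refl eq[symmetric]])
  also have "\<dots> = (\<Sum>xs\<in>?P. \<Sum>i\<in>{k..<card S}. H xs * g (xs ! i))"
    by (rule sum.swap)
  also have "\<dots> = (\<Sum>xs\<in>?P. H xs * (\<Sum>i\<in>{k..<card S}. g (xs ! i)))"
    by (simp only: sum_distrib_left)
  finally show ?thesis .
qed

section \<open>Moments of sampling without replacement\<close>

text \<open>By exchangeability the cross moment is the same for every partner position
  \<open>l\<close> other than \<open>i\<close>. Since \<open>g\<close> sums to zero over
  \<open>S\<close>, the values at these positions add up to \<open>- g (xs ! i)\<close>, so the
  cross moments together give the negative of a sum of squares.\<close>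

lemma cross_moment_nonpos:
  fixes g :: "'a \<Rightarrow> real"
  assumes g: "(\<Sum>j\<in>S. g j) = 0" and ij: "i < card S" "j < card S" "i \<noteq> j"
  shows "(\<Sum>xs\<in>permutations_of_set S. g (xs ! i) * g (xs ! j)) \<le> 0"
proof -
  let ?P = "permutations_of_set S"
  have eq: "(\<Sum>xs\<in>?P. g (xs ! i) * g (xs ! l)) = (\<Sum>xs\<in>?P. g (xs ! i) * g (xs ! j))"
    if l: "l \<in> {..<card S} - {i}" for l
  proof -
    have "(\<Sum>xs\<in>?P. g (xs ! i) * g (xs ! l)) =
        (\<Sum>xs\<in>?P. g (swap_at j l xs ! i) * g (swap_at j l xs ! j))"
      by (rule sum.cong[OF refl])
         (use l ij in \<open>auto simp: nth_swap_at length_permutations_of_set\<close>)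
    also have "\<dots> = (\<Sum>xs\<in>?P. g (xs ! i) * g (xs ! j))"
      using l ij by (intro sum_permutations_swap_at[where F = "\<lambda>xs. g (xs ! i) * g (xs ! j)"]) auto
    finally show ?thesis .
  qed
  have "real (card ({..<card S} - {i})) * (\<Sum>xs\<in>?P. g (xs ! i) * g (xs ! j))
      = (\<Sum>l\<in>{..<card S} - {i}. \<Sum>xs\<in>?P. g (xs ! i) * g (xs ! l))"
    using eq by simp
  also have "\<dots> = (\<Sum>xs\<in>?P. g (xs ! i) * (\<Sum>l\<in>{..<card S} - {i}. g (xs ! l)))"
    by (simp add: sum_distrib_left sum.swap[of _ _ ?P])
  also have "\<dots> = (\<Sum>xs\<in>?P. - (g (xs ! i))\<^sup>2)"
  proof (rule sum.cong[OF refl])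
    fix xs assume "xs \<in> ?P"
    from sum_nth_permutation[OF this, of g]
    have "(\<Sum>l\<in>{..<card S} - {i}. g (xs ! l)) = - g (xs ! i)"
      using g ij(1) by (simp add: sum_diff1)
    then show "g (xs ! i) * (\<Sum>l\<in>{..<card S} - {i}. g (xs ! l)) = - (g (xs ! i))\<^sup>2"
      by (simp add: power2_eq_square)
  qed
  also have "\<dots> \<le> 0" by (intro sum_nonpos) simp
  finally have "real (card ({..<card S} - {i})) * (\<Sum>xs\<in>?P. g (xs ! i) * g (xs ! j)) \<le> 0" .
  moreover have "real (card ({..<card S} - {i})) > 0"
    using ij by (auto simp: card_gt_0_iff)
  ultimately show ?thesis by (metis mult_le_0_iff not_le)
qed

text \<open>After expanding the square, the off-diagonal terms are nonpositive and each diagonal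
  term is at most \<open>M\<^sup>2\<close>. The bound is the one for independent centred
  draws.\<close>

lemma second_moment_sampling:
  fixes g :: "'a \<Rightarrow> real"
  assumes g: "(\<Sum>j\<in>S. g j) = 0" and M: "\<And>j. j \<in> S \<Longrightarrow> \<bar>g j\<bar> \<le> M"
    and I: "I \<subseteq> {..<card S}"
  shows "(\<Sum>xs\<in>permutations_of_set S. (\<Sum>i\<in>I. g (xs ! i))\<^sup>2)
    \<le> real (card (permutations_of_set S)) * (real (card I) * M\<^sup>2)"
proof -
  let ?P = "permutations_of_set S"
  have finI: "finite I" using I finite_subset by blast
  have "(\<Sum>xs\<in>?P. (\<Sum>i\<in>I. g (xs ! i))\<^sup>2)
      = (\<Sum>i\<in>I. \<Sum>j\<in>I. \<Sum>xs\<in>?P. g (xs ! i) * g (xs ! j))"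
    by (simp add: power2_eq_square sum_product sum.swap[of _ _ ?P])
  also have "\<dots> \<le> (\<Sum>i\<in>I. \<Sum>j\<in>I. if j = i then real (card ?P) * M\<^sup>2 else 0)"
  proof (intro sum_mono)
    fix i j assume ij: "i \<in> I" "j \<in> I"
    show "(\<Sum>xs\<in>?P. g (xs ! i) * g (xs ! j)) \<le> (if j = i then real (card ?P) * M\<^sup>2 else 0)"
    proof (cases "j = i")
      case True
      have "(\<Sum>xs\<in>?P. g (xs ! i) * g (xs ! i)) \<le> (\<Sum>xs\<in>?P. M\<^sup>2)"
      proof (rule sum_mono)
        fix xs assume xs: "xs \<in> ?P"
        have "xs ! i \<in> S"
          using xs ij I length_permutations_of_set[OF xs]
          by (auto simp: permutations_of_set_def)
        then have "\<bar>g (xs ! i)\<bar> \<le> \<bar>M\<bar>" using M by fastforce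
        then show "g (xs ! i) * g (xs ! i) \<le> M\<^sup>2"
          by (simp add: abs_le_square_iff power2_eq_square)
      qed
      then show ?thesis using True by simp
    next
      case False
      then show ?thesis using cross_moment_nonpos[OF g, of i j] ij I by auto
    qed
  qed
  also have "\<dots> = real (card ?P) * (real (card I) * M\<^sup>2)"
    using finI by simp
  finally show ?thesis .
qed

text \<open>Given the first \<open>k\<close> entries, the next value of \<open>h i\<close> has as
  its mean the average over the remaining positions. This average is not zero, but it is small in
  mean square by \<open>second_moment_sampling\<close>; Cauchy-Schwarz over coordinates and then
  over orders gives the bound.\<close>

lemma sum_inner_past_next_ge:
  fixes y :: "'a list \<Rightarrow> nat \<Rightarrow> real" and h :: "nat \<Rightarrow> 'a \<Rightarrow> real"
  assumes past: "\<And>xs ys i. xs \<in> permutations_of_set S \<Longrightarrow> ys \<in> permutations_of_set S \<Longrightarrow>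
      take k xs = take k ys \<Longrightarrow> i < m \<Longrightarrow> y xs i = y ys i"
    and k: "k < card S"
    and h: "\<And>i. i < m \<Longrightarrow> (\<Sum>j\<in>S. h i j) = 0"
    and M: "\<And>i j. i < m \<Longrightarrow> j \<in> S \<Longrightarrow> \<bar>h i j\<bar> \<le> M" "M \<ge> 0"
    and B: "\<And>xs. xs \<in> permutations_of_set S \<Longrightarrow> L2_set (y xs) {..<m} \<le> B" "B \<ge> 0"
  shows "(\<Sum>xs\<in>permutations_of_set S. \<Sum>i<m. y xs i * h i (xs ! k))
    \<ge> - (real (card (permutations_of_set S)) * (B * M * sqrt (real m) / sqrt (real (card S - k))))"
proof -
  let ?P = "permutations_of_set S"
  define s where "s = real (card S - k)"
  have s: "s > 0" using k by (simp add: s_def)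
  \<comment> \<open>The sum over the positions still to come, that is, \<open>s\<close> times the
    conditional mean of \<open>h i (xs ! k)\<close>.\<close>
  define T where "T xs i = (\<Sum>l\<in>{k..<card S}. h i (xs ! l))" for xs i
  define p where "p = real (card ?P)"
  have p0: "p \<ge> 0" by (simp add: p_def)
  let ?L = "\<Sum>xs\<in>?P. \<Sum>i<m. y xs i * h i (xs ! k)"
  have "s * ?L = (\<Sum>i<m. s * (\<Sum>xs\<in>?P. y xs i * h i (xs ! k)))"
    by (simp add: sum.swap[of _ _ ?P] sum_distrib_left)
  also have "\<dots> = (\<Sum>i<m. \<Sum>xs\<in>?P. y xs i * T xs i)"
  proof (rule sum.cong[OF refl])
    fix i assume "i \<in> {..<m}"
    then have i: "i < m" by simp
    show "s * (\<Sum>xs\<in>?P. y xs i * h i (xs ! k)) = (\<Sum>xs\<in>?P. y xs i * T xs i)"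
      unfolding s_def T_def
      by (rule sum_past_times_next[OF _ k]) (rule past[OF _ _ _ i])
  qed
  also have "\<dots> = (\<Sum>xs\<in>?P. \<Sum>i<m. y xs i * T xs i)"
    by (rule sum.swap)
  finally have sL: "s * ?L = (\<Sum>xs\<in>?P. \<Sum>i<m. y xs i * T xs i)" .
  have "(\<Sum>xs\<in>?P. (L2_set (T xs) {..<m})\<^sup>2) = (\<Sum>xs\<in>?P. \<Sum>i<m. (T xs i)\<^sup>2)"
    by (simp add: L2_set_def sum_nonneg)
  also have "\<dots> = (\<Sum>i<m. \<Sum>xs\<in>?P. (T xs i)\<^sup>2)" by (rule sum.swap)
  also have "\<dots> \<le> (\<Sum>i<m. p * (s * M\<^sup>2))"
  proof (rule sum_mono)
    fix i assume i: "i \<in> {..<m}"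
    show "(\<Sum>xs\<in>?P. (T xs i)\<^sup>2) \<le> p * (s * M\<^sup>2)"
      using second_moment_sampling[of "h i" S M "{k..<card S}", OF h M(1)] i
      by (force simp: T_def p_def s_def)
  qed
  also have "\<dots> = p * (M\<^sup>2 * (m * s))" by simp
  finally have T2: "(\<Sum>xs\<in>?P. (L2_set (T xs) {..<m})\<^sup>2) \<le> p * (M\<^sup>2 * (m * s))" .
  \<comment> \<open>Cauchy-Schwarz against the constant 1 passes from the mean square of the norm to
    its mean.\<close>
  have "(\<Sum>xs\<in>?P. L2_set (T xs) {..<m})\<^sup>2 \<le> (\<Sum>xs\<in>?P. (L2_set (T xs) {..<m})\<^sup>2) * p"
    using Cauchy_Schwarz_ineq_sum[of "\<lambda>xs. L2_set (T xs) {..<m}" "\<lambda>_. 1" ?P]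
    by (simp add: p_def)
  also have "\<dots> \<le> p * (M\<^sup>2 * (m * s)) * p"
    using T2 p0 by (rule mult_right_mono)
  also have "\<dots> = (p * M * sqrt m * sqrt s)\<^sup>2"
    using s by (simp add: power_mult_distrib) (simp add: power2_eq_square)
  finally have T1: "(\<Sum>xs\<in>?P. L2_set (T xs) {..<m}) \<le> p * M * sqrt m * sqrt s"
    by (rule power2_le_imp_le) (use p0 M(2) s in auto)
  have "- (s * ?L) = (\<Sum>xs\<in>?P. - (\<Sum>i<m. y xs i * T xs i))"
    by (simp only: sL sum_negf)
  also have "\<dots> \<le> (\<Sum>xs\<in>?P. B * L2_set (T xs) {..<m})"
  proof (rule sum_mono)
    fix xs assume xs: "xs \<in> ?P"
    have "- (\<Sum>i<m. y xs i * T xs i) \<le> (\<Sum>i<m. \<bar>y xs i\<bar> * \<bar>T xs i\<bar>)"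
      unfolding sum_negf[symmetric]
      by (rule sum_mono) (metis abs_ge_minus_self abs_mult)
    also have "\<dots> \<le> L2_set (y xs) {..<m} * L2_set (T xs) {..<m}"
      by (rule L2_set_mult_ineq)
    also have "\<dots> \<le> B * L2_set (T xs) {..<m}"
      using B(1)[OF xs] by (intro mult_right_mono) auto
    finally show "- (\<Sum>i<m. y xs i * T xs i) \<le> B * L2_set (T xs) {..<m}" .
  qed
  also have "\<dots> \<le> B * (p * M * sqrt m * sqrt s)"
    unfolding sum_distrib_left[symmetric] using T1 B(2) by (rule mult_left_mono)
  also have "\<dots> = s * (p * (B * M * sqrt m / sqrt s))"
    using s by (simp add: field_simps)
  finally have "s * (- ?L) \<le> s * (p * (B * M * sqrt m / sqrt s))" by simp
  then have "- ?L \<le> p * (B * M * sqrt m / sqrt s)"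
    using s by (rule mult_left_le_imp_le)
  then show ?thesis unfolding p_def s_def by linarith
qed

text \<open>The induction step is \<open>1 / v <= 2 * (v - u)\<close> for consecutive roots
  \<open>u\<close> and \<open>v\<close>, which is \<open>(u - v)\<^sup>2 >= 0\<close> combined with
  \<open>v\<^sup>2 = u\<^sup>2 + 1\<close>.\<close>

lemma sum_inverse_sqrt_le: "(\<Sum>s=1..N. 1 / sqrt (real s)) \<le> 2 * sqrt (real N)"
proof (induction N)
  case (Suc N)
  define u v where "u = sqrt (real N)" and "v = sqrt (real (Suc N))"
  have uv: "v > 0" "v\<^sup>2 = u\<^sup>2 + 1" by (auto simp: u_def v_def)
  have "0 \<le> (u - v)\<^sup>2" by simp
  then have "2 * u * v + 1 \<le> 2 * v * v"
    using uv(2) unfolding power2_diff power2_eq_square by argo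
  then have "2 * u + 1 / v \<le> 2 * v" using uv(1) by (simp add: field_simps)
  then show ?case using Suc by (simp add: u_def v_def)
qed simp

section \<open>Projected steps\<close>

text \<open>Taking the positive part cannot increase the square, so the unprojected square can be
  expanded. The inner product is then controlled by a telescoping difference of energies.\<close>

lemma projected_step_energy:
  fixes y g y' :: "nat \<Rightarrow> real"
  assumes "\<And>i. i < m \<Longrightarrow> y' i = max 0 (y i - \<gamma> * g i)" "\<And>i. i < m \<Longrightarrow> \<bar>g i\<bar> \<le> G"
  shows "(\<Sum>i<m. (y' i)\<^sup>2) \<le> (\<Sum>i<m. (y i)\<^sup>2) - 2 * \<gamma> * (\<Sum>i<m. y i * g i) + \<gamma>\<^sup>2 * (m * G\<^sup>2)"
proof -
  have "(\<Sum>i<m. (y' i)\<^sup>2) \<le> (\<Sum>i<m. (y i)\<^sup>2 - 2 * \<gamma> * (y i * g i) + \<gamma>\<^sup>2 * G\<^sup>2)"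
  proof (rule sum_mono)
    fix i assume "i \<in> {..<m}"
    then have y': "y' i = max 0 (y i - \<gamma> * g i)" and g: "\<bar>g i\<bar> \<le> \<bar>G\<bar>"
      using assms by fastforce+
    have "(y' i)\<^sup>2 \<le> (y i - \<gamma> * g i)\<^sup>2" unfolding y' by (auto simp: max_def)
    also have "\<dots> = (y i)\<^sup>2 - 2 * \<gamma> * (y i * g i) + \<gamma>\<^sup>2 * (g i)\<^sup>2"
      by (simp add: power2_eq_square algebra_simps)
    also have "\<dots> \<le> (y i)\<^sup>2 - 2 * \<gamma> * (y i * g i) + \<gamma>\<^sup>2 * G\<^sup>2"
      using g by (intro add_left_mono mult_left_mono) (auto simp: abs_le_square_iff)
    finally show "(y' i)\<^sup>2 \<le> (y i)\<^sup>2 - 2 * \<gamma> * (y i * g i) + \<gamma>\<^sup>2 * G\<^sup>2" .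
  qed
  also have "\<dots> = (\<Sum>i<m. (y i)\<^sup>2) - 2 * \<gamma> * (\<Sum>i<m. y i * g i) + \<gamma>\<^sup>2 * (m * G\<^sup>2)"
    by (simp add: sum.distrib sum_subtractf sum_distrib_left)
  finally show ?thesis .
qed

text \<open>No sign of \<open>y\<close> is assumed, so this also covers the step from the start
  point. The increment is estimated by the sum of its entries, whence the factor
  \<open>m\<close>.\<close>

lemma projected_step_norm:
  fixes y g y' :: "nat \<Rightarrow> real"
  assumes "\<And>i. i < m \<Longrightarrow> y' i = max 0 (y i - \<gamma> * g i)" "\<And>i. i < m \<Longrightarrow> \<bar>g i\<bar> \<le> G" "\<gamma> \<ge> 0"
  shows "L2_set y' {..<m} \<le> L2_set y {..<m} + \<gamma> * (m * G)"
proof -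
  have "L2_set y' {..<m} = L2_set (\<lambda>i. \<bar>y' i\<bar>) {..<m}"
    by (simp add: L2_set_def)
  also have "\<dots> \<le> L2_set (\<lambda>i. \<bar>y i\<bar> + \<gamma> * \<bar>g i\<bar>) {..<m}"
  proof (rule L2_set_mono)
    fix i assume "i \<in> {..<m}"
    then have "y' i = max 0 (y i - \<gamma> * g i)" using assms by auto
    moreover have "\<bar>\<gamma> * g i\<bar> = \<gamma> * \<bar>g i\<bar>" using assms(3) by (simp add: abs_mult)
    ultimately show "\<bar>y' i\<bar> \<le> \<bar>y i\<bar> + \<gamma> * \<bar>g i\<bar>" by linarith
  qed simp
  also have "\<dots> \<le> L2_set (\<lambda>i. \<bar>y i\<bar>) {..<m} + L2_set (\<lambda>i. \<gamma> * \<bar>g i\<bar>) {..<m}"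
    by (rule L2_set_triangle_ineq)
  also have "L2_set (\<lambda>i. \<gamma> * \<bar>g i\<bar>) {..<m} \<le> (\<Sum>i<m. \<gamma> * \<bar>g i\<bar>)"
    using assms(3) by (intro L2_set_le_sum) auto
  also have "\<dots> \<le> (\<Sum>i<m. \<gamma> * G)"
    using assms by (intro sum_mono mult_left_mono) auto
  finally show ?thesis by (simp add: L2_set_def algebra_simps)
qed

text \<open>A nonnegative entry is moved by the projected step no further than by the unprojected
  one. A negative entry could jump to zero, which is why \<open>y\<close> is taken
  nonnegative.\<close>

lemma projected_step_move:
  fixes y g y' :: "nat \<Rightarrow> real"
  assumes y': "\<And>i. i < m \<Longrightarrow> y' i = max 0 (y i - \<gamma> * g i)" and g: "\<And>i. i < m \<Longrightarrow> \<bar>g i\<bar> \<le> G"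
    and "\<gamma> \<ge> 0" and y: "\<And>i. i < m \<Longrightarrow> y i \<ge> 0"
    and a: "\<And>i. i < m \<Longrightarrow> \<bar>a i\<bar> \<le> G"
  shows "\<bar>(\<Sum>i<m. a i * y' i) - (\<Sum>i<m. a i * y i)\<bar> \<le> \<gamma> * m * G\<^sup>2"
proof -
  have "\<bar>(\<Sum>i<m. a i * y' i) - (\<Sum>i<m. a i * y i)\<bar> = \<bar>\<Sum>i<m. a i * (y' i - y i)\<bar>"
    by (simp add: sum_subtractf right_diff_distrib)
  also have "\<dots> \<le> (\<Sum>i<m. \<bar>a i * (y' i - y i)\<bar>)" by (rule sum_abs)
  also have "\<dots> \<le> (\<Sum>i<m. G * (\<gamma> * G))"
  proof (rule sum_mono)
    fix i assume "i \<in> {..<m}"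
    then have i: "i < m" by simp
    have "\<bar>y' i - y i\<bar> \<le> \<bar>\<gamma> * g i\<bar>" using y'[OF i] y[OF i] by linarith
    also have "\<dots> \<le> \<gamma> * G" using g[OF i] assms(3) by (simp add: abs_mult mult_left_mono)
    finally have "\<bar>y' i - y i\<bar> \<le> \<gamma> * G" .
    then show "\<bar>a i * (y' i - y i)\<bar> \<le> G * (\<gamma> * G)"
      unfolding abs_mult using a[OF i] by (intro mult_mono) auto
  qed
  finally show ?thesis by (simp add: power2_eq_square algebra_simps)
qed

text \<open>The conditions on \<open>x\<close> and \<open>x'\<close> say that each maximises
  \<open>t * z\<close> over \<open>t\<close> in \<open>[0, 1]\<close> at its own reduced cost
  \<open>z\<close>; comparing them gives \<open>(x - x') * (V - U) <= 0\<close>. Firm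
  nonexpansiveness of the projection bounds the squared distance of \<open>u\<close> and
  \<open>v\<close> by \<open>\<gamma>\<close> times this product, so \<open>u\<close> and
  \<open>v\<close> agree although \<open>x\<close> and \<open>x'\<close> may differ.\<close>

lemma projected_proximal_unique:
  fixes u v p a :: "nat \<Rightarrow> real"
  assumes "\<gamma> \<ge> 0"
    and u: "\<And>i. i < m \<Longrightarrow> u i = max 0 (p i + \<gamma> * (x * a i))"
    and v: "\<And>i. i < m \<Longrightarrow> v i = max 0 (p i + \<gamma> * (x' * a i))"
    and x: "0 \<le> x" "x \<le> 1" "x * (c - (\<Sum>i<m. a i * u i)) = max 0 (c - (\<Sum>i<m. a i * u i))"
    and x': "0 \<le> x'" "x' \<le> 1" "x' * (c - (\<Sum>i<m. a i * v i)) = max 0 (c - (\<Sum>i<m. a i * v i))"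
    and i: "i < m"
  shows "u i = v i"
proof -
  define U V where "U = c - (\<Sum>i<m. a i * u i)" and "V = c - (\<Sum>i<m. a i * v i)"
  have le_pos: "t * z \<le> max 0 z" if "0 \<le> t" "t \<le> 1" for t z :: real
    using that mult_left_le_one_le[of z t] mult_nonneg_nonpos[of t z]
    by (cases "0 \<le> z") (auto simp: max_def)
  have "x' * U \<le> x * U" "x * V \<le> x' * V"
    using le_pos x x' unfolding U_def V_def by metis+
  then have "(x - x') * (V - U) \<le> 0" by (simp add: algebra_simps)
  moreover have "(\<Sum>i<m. (u i - v i)\<^sup>2) \<le> (\<Sum>i<m. \<gamma> * ((x - x') * (a i * u i - a i * v i)))"
  proof (rule sum_mono)
    fix i assume "i \<in> {..<m}"
    then have i: "i < m" by simp
    define q r where "q = p i + \<gamma> * (x * a i)" and "r = p i + \<gamma> * (x' * a i)"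
    have "(max 0 q - max 0 r)\<^sup>2 \<le> (q - r) * (max 0 q - max 0 r)"
      unfolding power2_eq_square by (auto simp: max_def mult_le_cancel_right
        intro: mult_right_mono mult_right_mono_neg)
    moreover have "q - r = \<gamma> * ((x - x') * a i)" by (simp add: q_def r_def algebra_simps)
    ultimately show "(u i - v i)\<^sup>2 \<le> \<gamma> * ((x - x') * (a i * u i - a i * v i))"
      using u[OF i] v[OF i] by (simp add: q_def r_def algebra_simps)
  qed
  moreover have "(\<Sum>i<m. \<gamma> * ((x - x') * (a i * u i - a i * v i))) = \<gamma> * ((x - x') * (V - U))"
    by (simp add: U_def V_def sum_distrib_left[symmetric] sum_subtractf)
  ultimately have "(\<Sum>i<m. (u i - v i)\<^sup>2) \<le> 0"
    using \<open>\<gamma> \<ge> 0\<close> by (simp add: mult_nonneg_nonpos order_trans)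
  moreover have "(u i - v i)\<^sup>2 \<le> (\<Sum>i<m. (u i - v i)\<^sup>2)"
    using i by (intro member_le_sum) auto
  ultimately have "(u i - v i)\<^sup>2 \<le> 0" by linarith
  then show ?thesis by simp
qed

section \<open>Online linear programs in random order\<close>

text \<open>Covers both updates at once: \<open>X_optimal\<close> states complementarity at the
  current point (explicit update) or at the next one (implicit update). Nonanticipation is demanded
  of the dual points only, because a non-unique multiplier \<open>X\<close> may be chosen with
  knowledge of the whole order.\<close>

locale online_lp =
  fixes S :: "'a set" and m :: nat and cost :: "'a \<Rightarrow> real" and a :: "'a \<Rightarrow> nat \<Rightarrow> real"
    and d :: "nat \<Rightarrow> real" and \<gamma> abar cbar dlow dbar R :: real
    and Y :: "'a list \<Rightarrow> nat \<Rightarrow> nat \<Rightarrow> real" and X :: "'a list \<Rightarrow> nat \<Rightarrow> real"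
  assumes finite_S: "finite S" and S_nonempty: "S \<noteq> {}"
    and \<gamma>_pos: "\<gamma> > 0" and dlow_pos: "dlow > 0" and R_nonneg: "R \<ge> 0"
    and abar_nonneg: "abar \<ge> 0" and cbar_nonneg: "cbar \<ge> 0" and dbar_nonneg: "dbar \<ge> 0"
    and a_bound: "\<And>j i. j \<in> S \<Longrightarrow> i < m \<Longrightarrow> \<bar>a j i\<bar> \<le> abar"
    and cost_bound: "\<And>j. j \<in> S \<Longrightarrow> \<bar>cost j\<bar> \<le> cbar"
    and d_bound: "\<And>i. i < m \<Longrightarrow> dlow \<le> d i \<and> d i \<le> dbar"
    and step: "\<And>xs k i. xs \<in> permutations_of_set S \<Longrightarrow> k < card S \<Longrightarrow> i < m \<Longrightarrow>
      Y xs (Suc k) i = max 0 (Y xs k i - \<gamma> * (d i - X xs k * a (xs ! k) i))"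
    and X_range: "\<And>xs k. xs \<in> permutations_of_set S \<Longrightarrow> k < card S \<Longrightarrow> 0 \<le> X xs k \<and> X xs k \<le> 1"
    and X_optimal: "\<And>xs k. xs \<in> permutations_of_set S \<Longrightarrow> k < card S \<Longrightarrow>
      \<exists>w\<in>{Y xs k, Y xs (Suc k)}. X xs k * (cost (xs ! k) - (\<Sum>i<m. a (xs ! k) i * w i))
        = max 0 (cost (xs ! k) - (\<Sum>i<m. a (xs ! k) i * w i))"
    and start: "\<And>xs. xs \<in> permutations_of_set S \<Longrightarrow> L2_set (Y xs 0) {..<m} \<le> R"
    and nonanticipating: "\<And>xs ys k i. xs \<in> permutations_of_set S \<Longrightarrow> ys \<in> permutations_of_set S \<Longrightarrow>
      k \<le> card S \<Longrightarrow> take k xs = take k ys \<Longrightarrow> i < m \<Longrightarrow> Y xs k i = Y ys k i"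
begin

definition G :: real where "G = abar + dbar"

text \<open>The fraction is the norm beyond which the drift outweighs all errors,
  \<open>\<gamma> * m * G\<close> is the overshoot of one step across it, and \<open>R\<close>
  accounts for the start point.\<close>

definition B :: real where "B = R + (cbar + 3 * \<gamma> * m * G\<^sup>2) / dlow + \<gamma> * m * G"

lemma G_nonneg: "G \<ge> 0"
  using abar_nonneg dbar_nonneg by (simp add: G_def)

lemma B_nonneg: "B \<ge> 0"
  unfolding B_def using G_nonneg \<gamma>_pos dlow_pos R_nonneg cbar_nonneg
  by (intro add_nonneg_nonneg divide_nonneg_nonneg) auto

lemma nth_in_S: "xs \<in> permutations_of_set S \<Longrightarrow> k < card S \<Longrightarrow> xs ! k \<in> S"
  using length_permutations_of_set[of xs S] by (auto simp: permutations_of_set_def)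

lemma subgradient_bound:
  assumes "xs \<in> permutations_of_set S" "k < card S" "i < m"
  shows "\<bar>d i - X xs k * a (xs ! k) i\<bar> \<le> G"
proof -
  have "\<bar>X xs k * a (xs ! k) i\<bar> \<le> 1 * abar"
    unfolding abs_mult using X_range assms a_bound nth_in_S by (intro mult_mono) auto
  moreover have "\<bar>d i\<bar> \<le> dbar" using d_bound[OF assms(3)] dlow_pos by auto
  ultimately show ?thesis unfolding G_def by linarith
qed

section \<open>A priori estimates for the dual iterates\<close>

text \<open>From \<open>k = 1\<close> on each point is a positive part; the start point carries no
  sign condition.\<close>

lemma Y_nonneg:
  assumes "xs \<in> permutations_of_set S" "1 \<le> k" "k \<le> card S" "i < m"
  shows "Y xs k i \<ge> 0"
  using step[OF assms(1) _ assms(4), of "k - 1"] assms by auto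

text \<open>Complementarity holds at \<open>w\<close>, the current or the next dual point. Passing
  between \<open>w\<close> and \<open>Y xs k\<close> changes the reduced cost by at most
  \<open>\<gamma> * m * G\<^sup>2\<close>, an error paid once for \<open>t\<close> and once for
  \<open>X xs k\<close>.\<close>

lemma near_optimal:
  assumes xs: "xs \<in> permutations_of_set S" and k: "1 \<le> k" "k < card S" and t: "0 \<le> t" "t \<le> 1"
  shows "t * (cost (xs ! k) - (\<Sum>i<m. a (xs ! k) i * Y xs k i))
    \<le> X xs k * (cost (xs ! k) - (\<Sum>i<m. a (xs ! k) i * Y xs k i)) + 2 * (\<gamma> * m * G\<^sup>2)"
proof -
  define \<delta> where "\<delta> = \<gamma> * m * G\<^sup>2"
  have \<delta>0: "\<delta> \<ge> 0" using \<gamma>_pos by (simp add: \<delta>_def)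
  define u where "u = cost (xs ! k) - (\<Sum>i<m. a (xs ! k) i * Y xs k i)"
  from X_optimal[OF xs k(2)] obtain w where w: "w \<in> {Y xs k, Y xs (Suc k)}"
    and opt: "X xs k * (cost (xs ! k) - (\<Sum>i<m. a (xs ! k) i * w i))
        = max 0 (cost (xs ! k) - (\<Sum>i<m. a (xs ! k) i * w i))" by blast
  define v where "v = cost (xs ! k) - (\<Sum>i<m. a (xs ! k) i * w i)"
  have a: "\<bar>a (xs ! k) i\<bar> \<le> G" if "i < m" for i
    using a_bound[OF nth_in_S[OF xs k(2)] that] dbar_nonneg by (simp add: G_def)
  have "\<bar>(\<Sum>i<m. a (xs ! k) i * Y xs (Suc k) i) - (\<Sum>i<m. a (xs ! k) i * Y xs k i)\<bar> \<le> \<delta>"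
    unfolding \<delta>_def
    by (rule projected_step_move[OF step[OF xs k(2)] subgradient_bound[OF xs k(2)]])
       (use \<gamma>_pos Y_nonneg[OF xs k(1)] k(2) a in auto)
  then have uv: "\<bar>u - v\<bar> \<le> \<delta>"
    using w \<delta>0 by (auto simp: u_def v_def)
  have scale: "s * e \<le> \<delta>" if "0 \<le> s" "s \<le> 1" "\<bar>e\<bar> \<le> \<delta>" for s e :: real
  proof -
    have "s * e \<le> s * \<delta>" using that by (intro mult_left_mono) auto
    also have "\<dots> \<le> \<delta>" using that \<delta>0 by (simp add: mult_left_le_one_le)
    finally show ?thesis .
  qed
  have "t * u = t * v + t * (u - v)" by (simp add: algebra_simps)
  also have "\<dots> \<le> max 0 v + \<delta>"
  proof (rule add_mono)
    show "t * v \<le> max 0 v"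
      using t mult_left_le_one_le[of v t] mult_nonneg_nonpos[of t v]
      by (cases "0 \<le> v") (auto simp: max_def)
    show "t * (u - v) \<le> \<delta>" using scale t uv by blast
  qed
  also have "max 0 v = X xs k * u + X xs k * (v - u)"
    using opt by (simp add: v_def algebra_simps)
  also have "X xs k * (v - u) \<le> \<delta>"
    using scale X_range[OF xs k(2)] uv by (simp add: abs_minus_commute)
  finally show ?thesis by (simp add: u_def \<delta>_def)
qed

text \<open>Below the threshold \<open>T\<close> one step adds at most
  \<open>\<gamma> * m * G\<close>; above it the drift along \<open>d\<close> dominates and the norm
  does not grow.\<close>

lemma norm_bound:
  assumes xs: "xs \<in> permutations_of_set S"
  shows "k \<le> card S \<Longrightarrow> L2_set (Y xs k) {..<m} \<le> B"
proof (induction k)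
  case 0
  have "0 \<le> (cbar + 3 * \<gamma> * m * G\<^sup>2) / dlow + \<gamma> * m * G"
    using G_nonneg \<gamma>_pos dlow_pos cbar_nonneg
    by (intro add_nonneg_nonneg divide_nonneg_nonneg) auto
  then show ?case using start[OF xs] by (simp add: B_def)
next
  case (Suc k)
  define T where "T = (cbar + 3 * \<gamma> * m * G\<^sup>2) / dlow"
  have T0: "T \<ge> 0"
    unfolding T_def using \<gamma>_pos dlow_pos cbar_nonneg by (intro divide_nonneg_nonneg) auto
  have k: "k < card S" using Suc.prems by simp
  define L where "L = L2_set (Y xs k) {..<m}"
  have up: "L2_set (Y xs (Suc k)) {..<m} \<le> L + \<gamma> * (m * G)"
    unfolding L_def
    by (rule projected_step_norm[OF step[OF xs k] subgradient_bound[OF xs k]]) (use \<gamma>_pos in auto)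
  show ?case
  \<comment> \<open>Step 0 is put with the small case: the drift argument needs nonnegative entries,
    and the start point is bounded by \<open>R\<close> anyway.\<close>
  proof (cases "k = 0 \<or> L < T")
    case True
    then have "L \<le> R + T" using start[OF xs] R_nonneg T0 by (auto simp: L_def)
    then show ?thesis using up by (simp add: B_def T_def)
  next
    case False
    then have k1: "1 \<le> k" and LT: "T \<le> L" by auto
    define \<delta> where "\<delta> = \<gamma> * m * G\<^sup>2"
    have \<delta>0: "\<delta> \<ge> 0" using \<gamma>_pos by (simp add: \<delta>_def)
    let ?g = "\<lambda>i. d i - X xs k * a (xs ! k) i"
    have "dlow * L \<le> dlow * (\<Sum>i<m. Y xs k i)"
      unfolding L_def using dlow_pos Y_nonneg[OF xs k1] k by (intro mult_left_mono L2_set_le_sum) auto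
    also have "\<dots> \<le> (\<Sum>i<m. d i * Y xs k i)"
      unfolding sum_distrib_left using d_bound Y_nonneg[OF xs k1] k
      by (intro sum_mono mult_right_mono) auto
    finally have dY: "dlow * L \<le> (\<Sum>i<m. d i * Y xs k i)" .
    have "X xs k * cost (xs ! k) \<le> 1 * cbar"
      using X_range[OF xs k] cost_bound[OF nth_in_S[OF xs k]] cbar_nonneg
      by (intro order_trans[OF mult_left_mono[of "cost (xs ! k)" cbar]] mult_right_mono) auto
    moreover have "0 \<le> X xs k * (cost (xs ! k) - (\<Sum>i<m. a (xs ! k) i * Y xs k i)) + 2 * \<delta>"
      \<comment> \<open>Comparison with \<open>t = 0\<close>: a column is taken only if its reduced
        cost is nonnegative up to \<open>2 * \<delta>\<close>.\<close>
      using near_optimal[OF xs k1 k, of 0] by (simp add: \<delta>_def)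
    ultimately have aY: "X xs k * (\<Sum>i<m. a (xs ! k) i * Y xs k i) \<le> cbar + 2 * \<delta>"
      by (simp add: algebra_simps)
    have gY: "(\<Sum>i<m. Y xs k i * ?g i)
        = (\<Sum>i<m. d i * Y xs k i) - X xs k * (\<Sum>i<m. a (xs ! k) i * Y xs k i)"
      by (simp add: sum_subtractf sum_distrib_left algebra_simps)
    have "dlow * T \<le> dlow * L" using LT dlow_pos by simp
    then have "cbar + 3 * \<delta> \<le> dlow * L" using dlow_pos by (simp add: T_def \<delta>_def)
    \<comment> \<open>The part from \<open>d\<close> is at least \<open>cbar + 3 * \<delta>\<close>
      and the part from the column at most \<open>cbar + 2 * \<delta>\<close>; the surplus
      \<open>\<delta>\<close> pays for the quadratic term of the energy.\<close>
    then have "\<delta> \<le> 2 * (\<Sum>i<m. Y xs k i * ?g i)" using dY aY gY \<delta>0 by linarith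
    then have "\<gamma> * \<delta> \<le> \<gamma> * (2 * (\<Sum>i<m. Y xs k i * ?g i))" using \<gamma>_pos by simp
    then have "\<gamma>\<^sup>2 * (m * G\<^sup>2) \<le> 2 * \<gamma> * (\<Sum>i<m. Y xs k i * ?g i)"
      by (simp add: \<delta>_def power2_eq_square algebra_simps)
    moreover have "(\<Sum>i<m. (Y xs (Suc k) i)\<^sup>2)
        \<le> (\<Sum>i<m. (Y xs k i)\<^sup>2) - 2 * \<gamma> * (\<Sum>i<m. Y xs k i * ?g i) + \<gamma>\<^sup>2 * (m * G\<^sup>2)"
      by (rule projected_step_energy[OF step[OF xs k] subgradient_bound[OF xs k]])
    ultimately have "(\<Sum>i<m. (Y xs (Suc k) i)\<^sup>2) \<le> (\<Sum>i<m. (Y xs k i)\<^sup>2)" by linarith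
    then have "L2_set (Y xs (Suc k)) {..<m} \<le> L2_set (Y xs k) {..<m}"
      by (simp add: L2_set_def)
    then show ?thesis using Suc by simp
  qed
qed

section \<open>Constraint usage and regret\<close>

text \<open>The positive part dominates its argument, so every excess of usage over
  \<open>d i\<close> shows up, times \<open>\<gamma>\<close>, as growth of the dual entry; the
  growth telescopes.\<close>

lemma usage_le:
  assumes xs: "xs \<in> permutations_of_set S" and i: "i < m"
  shows "(\<Sum>k<card S. X xs k * a (xs ! k) i - d i) \<le> (Y xs (card S) i - Y xs 0 i) / \<gamma>"
proof -
  have "(\<Sum>k<card S. X xs k * a (xs ! k) i - d i) \<le> (\<Sum>k<card S. (Y xs (Suc k) i - Y xs k i) / \<gamma>)"
  proof (rule sum_mono)
    fix k assume "k \<in> {..<card S}"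
    then have "\<gamma> * (X xs k * a (xs ! k) i - d i) \<le> Y xs (Suc k) i - Y xs k i"
      using step[OF xs _ i, of k] by (simp add: algebra_simps)
    then show "X xs k * a (xs ! k) i - d i \<le> (Y xs (Suc k) i - Y xs k i) / \<gamma>"
      using \<gamma>_pos by (simp add: pos_le_divide_eq mult.commute)
  qed
  also have "\<dots> = (Y xs (card S) i - Y xs 0 i) / \<gamma>"
    using sum_lessThan_telescope[of "\<lambda>k. Y xs k i" "card S"]
    by (simp add: sum_divide_distrib[symmetric])
  finally show ?thesis .
qed

text \<open>The start point may have negative entries, where the estimates above fail; hence the regret
  analysis treats step 0 separately and telescopes from step 1 on.\<close>

lemma energy_first:
  assumes xs: "xs \<in> permutations_of_set S"
  shows "(\<Sum>i<m. (Y xs 1 i)\<^sup>2) \<le> 2 * R\<^sup>2 + 2 * (\<gamma>\<^sup>2 * (m * G\<^sup>2))"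
proof -
  have N: "0 < card S" using finite_S S_nonempty by (simp add: card_gt_0_iff)
  let ?g = "\<lambda>i. d i - X xs 0 * a (xs ! 0) i"
  have "(L2_set (Y xs 0) {..<m})\<^sup>2 \<le> R\<^sup>2" using start[OF xs] by (intro power_mono) auto
  then have E0: "(\<Sum>i<m. (Y xs 0 i)\<^sup>2) \<le> R\<^sup>2" by (simp add: L2_set_def sum_nonneg)
  have "(\<Sum>i<m. (Y xs 1 i)\<^sup>2) \<le> (\<Sum>i<m. 2 * (Y xs 0 i)\<^sup>2 + 2 * (\<gamma>\<^sup>2 * G\<^sup>2))"
  proof (rule sum_mono)
    fix i assume "i \<in> {..<m}"
    then have i: "i < m" by simp
    have "(Y xs 1 i)\<^sup>2 \<le> (Y xs 0 i - \<gamma> * ?g i)\<^sup>2"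
      using step[OF xs N i] by (auto simp: max_def)
    \<comment> \<open>Adding the square with the opposite sign cancels the cross term, whose sign is
      unknown here.\<close>
    also have "\<dots> \<le> (Y xs 0 i - \<gamma> * ?g i)\<^sup>2 + (Y xs 0 i + \<gamma> * ?g i)\<^sup>2" by simp
    also have "\<dots> = 2 * (Y xs 0 i)\<^sup>2 + 2 * (\<gamma>\<^sup>2 * (?g i)\<^sup>2)"
      by (simp add: power2_eq_square algebra_simps)
    also have "\<dots> \<le> 2 * (Y xs 0 i)\<^sup>2 + 2 * (\<gamma>\<^sup>2 * G\<^sup>2)"
      using subgradient_bound[OF xs N i] G_nonneg
      by (intro add_left_mono mult_left_mono) (auto intro: power2_le_iff_abs_le[THEN iffD2])
    finally show "(Y xs 1 i)\<^sup>2 \<le> 2 * (Y xs 0 i)\<^sup>2 + 2 * (\<gamma>\<^sup>2 * G\<^sup>2)" .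
  qed
  also have "\<dots> = 2 * (\<Sum>i<m. (Y xs 0 i)\<^sup>2) + 2 * (\<gamma>\<^sup>2 * (m * G\<^sup>2))"
    by (simp add: sum.distrib sum_distrib_left)
  finally show ?thesis using E0 by linarith
qed

text \<open>Step 0 costs at most \<open>2 * cbar\<close>. Each later step loses
  \<open>2 * \<delta>\<close> to near optimality and \<open>\<delta> / 2\<close> to the energy
  estimate, while the energy after step 0 contributes
  \<open>R\<^sup>2 / \<gamma> + \<delta>\<close>.\<close>

lemma pathwise_regret:
  assumes xs: "xs \<in> permutations_of_set S" and t: "\<And>j. j \<in> S \<Longrightarrow> 0 \<le> t j \<and> t j \<le> 1"
  shows "(\<Sum>k<card S. cost (xs ! k) * (t (xs ! k) - X xs k))
    \<le> 2 * cbar + R\<^sup>2 / \<gamma> + 3 * \<gamma> * card S * m * G\<^sup>2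
      - (\<Sum>k\<in>{1..<card S}. \<Sum>i<m. Y xs k i * (d i - a (xs ! k) i * t (xs ! k)))"
proof -
  define N where "N = card S"
  have N: "0 < N" using finite_S S_nonempty by (simp add: card_gt_0_iff N_def)
  define \<delta> where "\<delta> = \<gamma> * m * G\<^sup>2"
  define E where "E k = (\<Sum>i<m. (Y xs k i)\<^sup>2)" for k
  define W where "W k = (\<Sum>i<m. Y xs k i * (d i - a (xs ! k) i * t (xs ! k)))" for k
  have first: "cost (xs ! 0) * (t (xs ! 0) - X xs 0) \<le> 2 * cbar"
  proof -
    have "cost (xs ! 0) * (t (xs ! 0) - X xs 0) \<le> \<bar>cost (xs ! 0)\<bar> * \<bar>t (xs ! 0) - X xs 0\<bar>"
      by (metis abs_ge_self abs_mult)
    also have "\<dots> \<le> cbar * 1"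
      using nth_in_S[OF xs, of 0] X_range[OF xs, of 0] t[of "xs ! 0"] cost_bound[of "xs ! 0"] N cbar_nonneg
      by (intro mult_mono) (auto simp: N_def)
    finally show ?thesis using cbar_nonneg by simp
  qed
  have later: "cost (xs ! k) * (t (xs ! k) - X xs k)
      \<le> 5 / 2 * \<delta> + (E k - E (Suc k)) / (2 * \<gamma>) - W k" if k: "k \<in> {1..<N}" for k
  proof -
    have k': "1 \<le> k" "k < card S" using k by (auto simp: N_def)
    define P where "P = (\<Sum>i<m. a (xs ! k) i * Y xs k i)"
    define Q where "Q = (\<Sum>i<m. Y xs k i * (d i - X xs k * a (xs ! k) i))"
    have "t (xs ! k) * (cost (xs ! k) - P) \<le> X xs k * (cost (xs ! k) - P) + 2 * \<delta>"
      unfolding P_def \<delta>_def using near_optimal[OF xs k'] t[OF nth_in_S[OF xs k'(2)]] by auto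
    moreover have "Q - W k = t (xs ! k) * P - X xs k * P"
      by (simp add: Q_def W_def P_def sum_subtractf[symmetric] sum_distrib_left algebra_simps)
    moreover have "Q \<le> (E k - E (Suc k)) / (2 * \<gamma>) + \<delta> / 2"
    proof -
      have "E (Suc k) \<le> E k - 2 * \<gamma> * Q + \<gamma>\<^sup>2 * (m * G\<^sup>2)"
        unfolding E_def Q_def
        by (rule projected_step_energy[OF step[OF xs k'(2)] subgradient_bound[OF xs k'(2)]])
      then have "2 * \<gamma> * Q \<le> (E k - E (Suc k)) + \<gamma> * \<delta>"
        by (simp add: \<delta>_def power2_eq_square algebra_simps)
      then show ?thesis using \<gamma>_pos by (simp add: field_simps)
    qed
    ultimately show ?thesis by (simp add: algebra_simps)
  qed
  have tele: "(\<Sum>k\<in>{1..<N}. E k - E (Suc k)) = E 1 - E N"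
    using sum_Suc_diff'[of 1 N "\<lambda>k. - E k"] N by simp
  have "E N \<ge> 0" by (simp add: E_def sum_nonneg)
  then have "E 1 - E N \<le> 2 * R\<^sup>2 + 2 * (\<gamma>\<^sup>2 * (m * G\<^sup>2))"
    using energy_first[OF xs] by (simp add: E_def)
  then have "(E 1 - E N) / (2 * \<gamma>) \<le> (2 * R\<^sup>2 + 2 * (\<gamma>\<^sup>2 * (m * G\<^sup>2))) / (2 * \<gamma>)"
    using \<gamma>_pos by (intro divide_right_mono) auto
  also have "\<dots> = R\<^sup>2 / \<gamma> + \<delta>"
    using \<gamma>_pos by (simp add: \<delta>_def field_simps power2_eq_square)
  finally have E1: "(E 1 - E N) / (2 * \<gamma>) \<le> R\<^sup>2 / \<gamma> + \<delta>" .
  have "(\<Sum>k<N. cost (xs ! k) * (t (xs ! k) - X xs k))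
      = cost (xs ! 0) * (t (xs ! 0) - X xs 0) + (\<Sum>k\<in>{1..<N}. cost (xs ! k) * (t (xs ! k) - X xs k))"
    using N by (simp add: lessThan_atLeast0 sum.atLeast_Suc_lessThan)
  also have "\<dots> \<le> 2 * cbar + (\<Sum>k\<in>{1..<N}. 5 / 2 * \<delta> + (E k - E (Suc k)) / (2 * \<gamma>) - W k)"
    using first later by (intro add_mono sum_mono)
  also have "\<dots> = 2 * cbar + (real N - 1) * (5 / 2 * \<delta>) + (E 1 - E N) / (2 * \<gamma>) - (\<Sum>k\<in>{1..<N}. W k)"
    unfolding tele[symmetric] sum_divide_distrib
    using N by (simp add: sum.distrib sum_subtractf of_nat_diff)
  also have "\<dots> \<le> 2 * cbar + (real N - 1) * (3 * \<delta>) + R\<^sup>2 / \<gamma> + \<delta> - (\<Sum>k\<in>{1..<N}. W k)"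
  proof -
    \<comment> \<open>Rounding up to 3 lets the extra \<open>\<delta>\<close> be absorbed into
      \<open>3 * N * \<delta>\<close>.\<close>
    have "(real N - 1) * (5 / 2 * \<delta>) \<le> (real N - 1) * (3 * \<delta>)"
      using N \<gamma>_pos by (intro mult_left_mono) (auto simp: \<delta>_def)
    then show ?thesis using E1 by linarith
  qed
  also have "\<dots> \<le> 2 * cbar + R\<^sup>2 / \<gamma> + 3 * \<gamma> * N * m * G\<^sup>2 - (\<Sum>k\<in>{1..<N}. W k)"
    using \<gamma>_pos by (simp add: \<delta>_def algebra_simps)
  finally show ?thesis unfolding W_def N_def .
qed

text \<open>The comparison point \<open>t\<close> is the same for all orders, so averaging over the
  orders acts only on the terms \<open>W\<close>. The factor 4 is 2 from the bound
  \<open>2 * abar\<close> on \<open>h\<close> times 2 from the sum of inverse roots.\<close>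

theorem expected_regret:
  assumes t: "\<And>j. j \<in> S \<Longrightarrow> 0 \<le> t j \<and> t j \<le> 1"
    and feas: "\<And>i. i < m \<Longrightarrow> (\<Sum>j\<in>S. a j i * t j) \<le> card S * d i"
  shows "(\<Sum>xs\<in>permutations_of_set S. \<Sum>k<card S. cost (xs ! k) * (t (xs ! k) - X xs k))
    \<le> card (permutations_of_set S) *
      (2 * cbar + R\<^sup>2 / \<gamma> + 3 * \<gamma> * card S * m * G\<^sup>2 + 4 * abar * B * sqrt (card S * m))"
proof -
  let ?P = "permutations_of_set S"
  define p where "p = real (card ?P)"
  define N where "N = card S"
  have N: "0 < N" using finite_S S_nonempty by (simp add: card_gt_0_iff N_def)
  \<comment> \<open>Centred usage: the mean over \<open>S\<close> minus the usage of the item, so it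
    sums to zero.\<close>
  define h where "h i j = (\<Sum>j\<in>S. a j i * t j) / N - a j i * t j" for i j
  have h0: "(\<Sum>j\<in>S. h i j) = 0" for i
    using N by (simp add: h_def sum_subtractf N_def)
  have at: "\<bar>a j i * t j\<bar> \<le> abar" if "j \<in> S" "i < m" for i j
  proof -
    have "\<bar>a j i * t j\<bar> \<le> abar * 1"
      unfolding abs_mult using a_bound that t abar_nonneg by (intro mult_mono) auto
    then show ?thesis by simp
  qed
  have h_le: "\<bar>h i j\<bar> \<le> 2 * abar" if "i < m" "j \<in> S" for i j
  proof -
    have "\<bar>\<Sum>j\<in>S. a j i * t j\<bar> \<le> (\<Sum>j\<in>S. abar)"
      using at that(1) by (intro order_trans[OF sum_abs] sum_mono)
    then have "\<bar>(\<Sum>j\<in>S. a j i * t j) / N\<bar> \<le> abar"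
      using N by (simp add: N_def field_simps)
    then show ?thesis using at[OF that(2,1)] unfolding h_def by linarith
  qed
  define W where "W xs k = (\<Sum>i<m. Y xs k i * (d i - a (xs ! k) i * t (xs ! k)))" for xs k
  have WE: "(\<Sum>xs\<in>?P. W xs k) \<ge> - (p * (B * (2 * abar) * sqrt m / sqrt (N - k)))"
    if k: "k \<in> {1..<N}" for k
  proof -
    have "- (p * (B * (2 * abar) * sqrt m / sqrt (N - k)))
        \<le> (\<Sum>xs\<in>?P. \<Sum>i<m. Y xs k i * h i (xs ! k))"
      using k unfolding p_def N_def
      by (intro sum_inner_past_next_ge nonanticipating norm_bound h0 h_le B_nonneg)
         (auto simp: abar_nonneg)
    also have "\<dots> \<le> (\<Sum>xs\<in>?P. W xs k)"
      unfolding W_def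
    proof (intro sum_mono mult_left_mono)
      fix xs i assume xs: "xs \<in> ?P" and "i \<in> {..<m}"
      then have i: "i < m" by simp
      \<comment> \<open>Feasibility of \<open>t\<close> puts the mean usage below
        \<open>d i\<close>; multiplying by nonnegative dual entries keeps the inequality.\<close>
      show "h i (xs ! k) \<le> d i - a (xs ! k) i * t (xs ! k)"
        using feas[OF i] N by (simp add: h_def N_def field_simps)
      show "0 \<le> Y xs k i" using Y_nonneg[OF xs _ _ i] k by (simp add: N_def)
    qed
    finally show ?thesis .
  qed
  have "(\<Sum>k\<in>{1..<N}. 1 / sqrt (N - k)) = (\<Sum>s\<in>{1..<N}. 1 / sqrt (real s))"
    by (rule sum.reindex_bij_witness[where i = "\<lambda>s. N - s" and j = "\<lambda>s. N - s"]) auto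
  also have "\<dots> \<le> (\<Sum>s=1..N. 1 / sqrt (real s))"
    by (intro sum_mono2) auto
  also have "\<dots> \<le> 2 * sqrt N" by (rule sum_inverse_sqrt_le)
  finally have root: "(\<Sum>k\<in>{1..<N}. 1 / sqrt (N - k)) \<le> 2 * sqrt N" .
  have "- (\<Sum>xs\<in>?P. \<Sum>k\<in>{1..<N}. W xs k) = (\<Sum>k\<in>{1..<N}. - (\<Sum>xs\<in>?P. W xs k))"
    by (simp only: sum.swap[of _ _ ?P] sum_negf)
  also have "\<dots> \<le> (\<Sum>k\<in>{1..<N}. (p * (2 * abar * B * sqrt m)) * (1 / sqrt (N - k)))"
    using WE by (intro sum_mono) (fastforce simp: algebra_simps)
  also have "\<dots> = (p * (2 * abar * B * sqrt m)) * (\<Sum>k\<in>{1..<N}. 1 / sqrt (N - k))"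
    by (rule sum_distrib_left[symmetric])
  also have "\<dots> \<le> (p * (2 * abar * B * sqrt m)) * (2 * sqrt N)"
    using abar_nonneg B_nonneg by (intro mult_left_mono root) (auto simp: p_def)
  also have "\<dots> = p * (4 * abar * B * sqrt (N * m))"
    by (simp add: real_sqrt_mult)
  finally have WW: "- (\<Sum>xs\<in>?P. \<Sum>k\<in>{1..<N}. W xs k) \<le> p * (4 * abar * B * sqrt (N * m))" .
  have "(\<Sum>xs\<in>?P. \<Sum>k<N. cost (xs ! k) * (t (xs ! k) - X xs k))
      \<le> (\<Sum>xs\<in>?P. 2 * cbar + R\<^sup>2 / \<gamma> + 3 * \<gamma> * N * m * G\<^sup>2 - (\<Sum>k\<in>{1..<N}. W xs k))"
    unfolding N_def W_def by (intro sum_mono pathwise_regret t)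
  also have "\<dots> = p * (2 * cbar + R\<^sup>2 / \<gamma> + 3 * \<gamma> * N * m * G\<^sup>2) + - (\<Sum>xs\<in>?P. \<Sum>k\<in>{1..<N}. W xs k)"
    by (simp add: sum_subtractf p_def)
  also have "\<dots> \<le> p * (2 * cbar + R\<^sup>2 / \<gamma> + 3 * \<gamma> * N * m * G\<^sup>2) + p * (4 * abar * B * sqrt (N * m))"
    using WW by (rule add_left_mono)
  finally show ?thesis
    by (simp add: p_def N_def algebra_simps)
qed

end

section \<open>The duplicated problem\<close>

lemma scalar_prod_lessThan:
  "w \<in> carrier_vec m \<Longrightarrow> v \<bullet> w = (\<Sum>i<m. v $ i * w $ i)"
  by (auto simp: scalar_prod_def lessThan_atLeast0)

text \<open>For the implicit update the KKT system yields the same projected form as for the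
  explicit one, with complementarity at the new point instead of the old one.\<close>

lemma dual_step_projected:
  assumes step: "dual_step upd d \<gamma> ck ak y xk y'" and \<gamma>: "\<gamma> > 0"
    and dims: "d \<in> carrier_vec m" "ak \<in> carrier_vec m" "y \<in> carrier_vec m"
  shows "y' \<in> carrier_vec m" and "0 \<le> xk" and "xk \<le> 1"
    and "\<And>i. i < m \<Longrightarrow> y' $ i = max 0 (y $ i - \<gamma> * (d $ i - xk * ak $ i))"
    and "let w = (case upd of Explicit \<Rightarrow> y | Implicit \<Rightarrow> y') in
      xk * (ck - (\<Sum>i<m. ak $ i * w $ i)) = max 0 (ck - (\<Sum>i<m. ak $ i * w $ i))"
proof -
  have "y' \<in> carrier_vec m \<and> 0 \<le> xk \<and> xk \<le> 1 \<and>
    (\<forall>i<m. y' $ i = max 0 (y $ i - \<gamma> * (d $ i - xk * ak $ i))) \<and>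
    (let w = (case upd of Explicit \<Rightarrow> y | Implicit \<Rightarrow> y') in
      xk * (ck - (\<Sum>i<m. ak $ i * w $ i)) = max 0 (ck - (\<Sum>i<m. ak $ i * w $ i)))"
  proof (cases upd)
    case Explicit
    then show ?thesis
      using step dims
      by (auto simp: explicit_step_def pos_part_def scalar_prod_lessThan[of _ m] max_def)
  next
    case Implicit
    then obtain s where feas: "prox_feasible m ck ak (y', s)"
      and mult: "prox_multiplier d \<gamma> ck ak y y' s xk"
      using step dims by (auto simp: implicit_step_def is_arg_min_def)
    have y': "y' \<in> carrier_vec m" "0\<^sub>v m \<le> y'" and s: "s \<ge> ck - ak \<bullet> y'" "s \<ge> 0"
      using feas by (auto simp: prox_feasible_def)
    from mult dims obtain z w where z: "z \<in> carrier_vec m" "0\<^sub>v m \<le> z" "z \<bullet> y' = 0"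
      and stat: "d + (1 / \<gamma>) \<cdot>\<^sub>v (y' - y) - xk \<cdot>\<^sub>v ak - z = 0\<^sub>v m"
      and w: "1 - xk - w = 0" "0 \<le> w" "w * s = 0"
      and xk: "0 \<le> xk" "xk * (s - (ck - ak \<bullet> y')) = 0"
      by (auto simp: prox_multiplier_def)
    have y'_nonneg: "0 \<le> y' $ i" and z_nonneg: "0 \<le> z $ i" if "i < m" for i
      using y' z that by (auto simp: less_eq_vec_def)
    have "(\<Sum>i<m. z $ i * y' $ i) = 0"
      using z(3) scalar_prod_lessThan[OF y'(1)] by simp
    then have compl: "z $ i * y' $ i = 0" if "i < m" for i
      using that y'_nonneg z_nonneg by (subst (asm) sum_nonneg_eq_0_iff) auto
    have "y' $ i = max 0 (y $ i - \<gamma> * (d $ i - xk * ak $ i))" if i: "i < m" for i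
    proof -
      have "(d + (1 / \<gamma>) \<cdot>\<^sub>v (y' - y) - xk \<cdot>\<^sub>v ak - z) $ i = 0"
        using stat i by simp
      then have "d $ i + (1 / \<gamma>) * (y' $ i - y $ i) - xk * ak $ i - z $ i = 0"
        using dims y'(1) z(1) i by simp
      \<comment> \<open>The new entry exceeds the unprojected step by
        \<open>\<gamma> * z $ i\<close>; since one of \<open>z $ i\<close> and \<open>y' $ i\<close>
        vanishes, this is the positive part.\<close>
      then have "\<gamma> * (d $ i - xk * ak $ i) + (y' $ i - y $ i) = \<gamma> * z $ i"
        using \<gamma> by (simp add: field_simps)
      moreover have "\<gamma> * z $ i \<ge> 0" using \<gamma> z_nonneg[OF i] by simp
      moreover have "y' $ i = 0 \<or> \<gamma> * z $ i = 0" using compl[OF i] by auto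
      ultimately show ?thesis using y'_nonneg[OF i] by (auto simp: max_def)
    qed
    moreover have "xk * (ck - ak \<bullet> y') = max 0 (ck - ak \<bullet> y')"
    \<comment> \<open>If \<open>s = 0\<close>, the reduced cost is nonpositive and its product with
      \<open>xk\<close> vanishes. Otherwise \<open>w = 0\<close>, hence \<open>xk = 1\<close>, and
      \<open>s\<close> equals the reduced cost.\<close>
    proof (cases "s = 0")
      case True
      then show ?thesis using xk s by (auto simp: max_def algebra_simps)
    next
      case False
      then have "xk = 1" using w by auto
      then show ?thesis using xk s by auto
    qed
    ultimately show ?thesis
      using y'(1) xk(1) w Implicit by (simp add: scalar_prod_lessThan[OF y'(1)])
  qed
  then show "y' \<in> carrier_vec m" "0 \<le> xk" "xk \<le> 1"
    "\<And>i. i < m \<Longrightarrow> y' $ i = max 0 (y $ i - \<gamma> * (d $ i - xk * ak $ i))"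
    "let w = (case upd of Explicit \<Rightarrow> y | Implicit \<Rightarrow> y') in
      xk * (ck - (\<Sum>i<m. ak $ i * w $ i)) = max 0 (ck - (\<Sum>i<m. ak $ i * w $ i))"
    by blast+
qed

text \<open>The multiplier need not be unique, but the dual point is; hence the dual iterates do not depend
  on the columns not yet seen.\<close>

lemma dual_step_unique:
  assumes s1: "dual_step upd d \<gamma> ck ak y x u" and s2: "dual_step upd d \<gamma> ck ak y x' v"
    and \<gamma>: "\<gamma> > 0"
    and dims: "d \<in> carrier_vec m" "ak \<in> carrier_vec m" "y \<in> carrier_vec m"
  shows "u = v"
proof (cases upd)
  case Explicit
  then show ?thesis using s1 s2 by (simp add: explicit_step_def)
next
  case Implicit
  note p1 = dual_step_projected[OF s1 \<gamma> dims] and p2 = dual_step_projected[OF s2 \<gamma> dims]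
  show ?thesis
  proof (rule eq_vecI)
    fix i assume "i < dim_vec v"
    then have i: "i < m" using p2(1) by simp
    show "u $ i = v $ i"
    proof (rule projected_proximal_unique[where \<gamma> = \<gamma> and m = m and u = "\<lambda>i. u $ i" and v = "\<lambda>i. v $ i"
          and p = "\<lambda>i. y $ i - \<gamma> * d $ i" and a = "\<lambda>i. ak $ i" and x = x and x' = x' and c = ck])
      show "u $ i = max 0 (y $ i - \<gamma> * d $ i + \<gamma> * (x * ak $ i))" if "i < m" for i
        using p1(4)[OF that] by (simp add: algebra_simps)
      show "v $ i = max 0 (y $ i - \<gamma> * d $ i + \<gamma> * (x' * ak $ i))" if "i < m" for i
        using p2(4)[OF that] by (simp add: algebra_simps)
    qed (use p1(2,3,5) p2(2,3,5) \<gamma> i Implicit in auto)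
  qed (use p1(1) p2(1) in auto)
qed

section \<open>From processing orders to the averaged output\<close>

text \<open>An order lists every copy once, so sums over time become sums over columns and copies.
  Taking \<open>X\<close> constantly 1 handles the comparison point.\<close>

lemma sum_order_copies:
  fixes X :: "nat \<times> nat \<Rightarrow> real"
  assumes "xs \<in> orders n K" "K \<ge> 1"
  shows "(\<Sum>k<n * K. w (fst (xs ! k)) * X (xs ! k))
    = real K * (\<Sum>j<n. w j * (1 / real K * (\<Sum>l<K. X (j, l))))"
proof -
  have "(\<Sum>k<n * K. w (fst (xs ! k)) * X (xs ! k)) = (\<Sum>p\<in>{..<n} \<times> {..<K}. w (fst p) * X p)"
    using sum_nth_permutation[OF assms(1)[unfolded orders_def], of "\<lambda>p. w (fst p) * X p"] by simp
  also have "\<dots> = (\<Sum>j<n. \<Sum>l<K. w j * X (j, l))"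
    by (simp add: sum.cartesian_product case_prod_unfold)
  also have "\<dots> = real K * (\<Sum>j<n. w j * (1 / real K * (\<Sum>l<K. X (j, l))))"
    using assms(2) by (simp add: sum_distrib_left)
  finally show ?thesis .
qed

text \<open>Applies the locale to the \<open>n * K\<close> copies for an arbitrary positive
  stepsize; dividing by \<open>K\<close> returns to the original problem. Here \<open>g\<close> and
  \<open>\<beta>\<close> are \<open>G\<close> and \<open>B\<close> of the locale.\<close>

lemma duplicated_lp_bounds:
  fixes A :: "real mat" and b c y1 :: "real vec" and xhat :: "(nat \<times> nat) list \<Rightarrow> real vec"
    and \<gamma> abar cbar dlow dbar R :: real and m n K :: nat
  defines "g \<equiv> abar + dbar"
  defines "\<beta> \<equiv> R + (cbar + 3 * \<gamma> * m * g\<^sup>2) / dlow + \<gamma> * m * g"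
  assumes size: "m \<ge> 1" "n \<ge> 1" "K \<ge> 1"
    and A: "A \<in> carrier_mat m n" and b: "b \<in> carrier_vec m" and c: "c \<in> carrier_vec n"
    and A1: "assm_A1 m n b dlow dbar" and A2: "assm_A2 m n A c abar cbar"
    and \<gamma>: "\<gamma> > 0" and y1: "y1 \<in> carrier_vec m" "l2norm y1 \<le> R"
    and out: "\<And>xs. xs \<in> orders n K \<Longrightarrow> dup_output upd A b c K \<gamma> y1 xs (xhat xs)"
  shows "order_expectation n K (\<lambda>xs. opt_gap A b c (xhat xs))
      \<le> (2 * cbar + R\<^sup>2 / \<gamma> + 3 * \<gamma> * (n * K) * m * g\<^sup>2 + 4 * abar * \<beta> * sqrt (n * K * m)) / K" (is ?gap)
    and "order_expectation n K (\<lambda>xs. violation A b (xhat xs)) \<le> 2 * \<beta> / (\<gamma> * K)" (is ?viol)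
proof -
  define S where "S = {..<n} \<times> {..<K}"
  have S: "finite S" "S \<noteq> {}" "card S = n * K" "orders n K = permutations_of_set S"
    using size by (auto simp: S_def orders_def lessThan_empty_iff)
  define d where "d = scaled_rhs n b"
  have d: "d \<in> carrier_vec m" using b by (simp add: d_def scaled_rhs_def)
  have d_nth: "d $ i = b $ i / n" if "i < m" for i
    using b that by (simp add: d_def scaled_rhs_def)
  have d_bound: "dlow \<le> d $ i \<and> d $ i \<le> dbar" if "i < m" for i
    using A1 that by (auto simp: assm_A1_def d_def[symmetric])
  have dlow: "dlow > 0" using A1 by (simp add: assm_A1_def)
  have dbar: "dbar > 0" using d_bound[of 0] dlow size by auto
  have abar: "abar > 0" "cbar > 0" using A2 by (auto simp: assm_A2_def)
  have R: "R \<ge> 0" using order_trans[OF L2_set_nonneg y1(2)[unfolded l2norm_def]] .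
  have dimA: "dim_col A = n" "dim_row A = m" using A by auto
  \<comment> \<open>One run is fixed for each order, as dual points paired with primal values;
    different orders may resolve a non-unique multiplier differently.\<close>
  have "\<forall>xs\<in>orders n K. \<exists>YX. fst YX 0 = y1 \<and>
        (\<forall>k<n * K. dual_step upd d \<gamma> (c $ fst (xs ! k)) (col A (fst (xs ! k)))
             (fst YX k) (snd YX (xs ! k)) (fst YX (Suc k))) \<and>
        xhat xs = vec n (\<lambda>j. 1 / real K * (\<Sum>l<K. snd YX (j, l)))"
    using out by (fastforce simp: dup_output_def dimA d_def)
  from bchoice[OF this] obtain YX where YX: "\<forall>xs\<in>orders n K. fst (YX xs) 0 = y1 \<and>
        (\<forall>k<n * K. dual_step upd d \<gamma> (c $ fst (xs ! k)) (col A (fst (xs ! k)))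
             (fst (YX xs) k) (snd (YX xs) (xs ! k)) (fst (YX xs) (Suc k))) \<and>
        xhat xs = vec n (\<lambda>j. 1 / real K * (\<Sum>l<K. snd (YX xs) (j, l)))" ..
  define Y where "Y = (\<lambda>xs. fst (YX xs))"
  define X where "X = (\<lambda>xs. snd (YX xs))"
  have Y0: "Y xs 0 = y1" if "xs \<in> permutations_of_set S" for xs
    using YX that by (simp add: Y_def S)
  have step: "dual_step upd d \<gamma> (c $ fst (xs ! k)) (col A (fst (xs ! k))) (Y xs k) (X xs (xs ! k)) (Y xs (Suc k))"
    if "xs \<in> permutations_of_set S" "k < card S" for xs k
    using YX that by (simp add: Y_def X_def S)
  have xhat: "xhat xs = vec n (\<lambda>j. 1 / real K * (\<Sum>l<K. X xs (j, l)))"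
    if "xs \<in> permutations_of_set S" for xs
    using YX that by (simp add: X_def S)
  have colA: "col A j \<in> carrier_vec m" for j
    by (rule carrier_vecI) (simp add: dimA)
  have Y_carrier: "k \<le> card S \<Longrightarrow> Y xs k \<in> carrier_vec m" if xs: "xs \<in> permutations_of_set S" for xs k
  proof (induction k)
    case 0
    show ?case using Y0[OF xs] y1(1) by simp
  next
    case (Suc k)
    then have "k < card S" "Y xs k \<in> carrier_vec m" by simp_all
    then show ?case by (intro dual_step_projected(1)[OF step[OF xs] \<gamma> d colA])
  qed
  note proj = dual_step_projected[OF step \<gamma> d colA Y_carrier]
  have past: "k \<le> card S \<Longrightarrow> take k xs = take k ys \<Longrightarrow> Y xs k = Y ys k"
    if xs: "xs \<in> permutations_of_set S" and ys: "ys \<in> permutations_of_set S" for xs ys k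
  proof (induction k)
    case 0
    then show ?case using Y0 xs ys by simp
  next
    case (Suc k)
    have k: "k < card S" using Suc.prems by simp
    have "take (Suc k) xs ! k = take (Suc k) ys ! k" using Suc.prems(2) by simp
    then have nth: "xs ! k = ys ! k" by simp
    have "take k (take (Suc k) xs) = take k (take (Suc k) ys)" using Suc.prems(2) by simp
    then have "Y xs k = Y ys k" using Suc.IH k by (simp add: min_def)
    then show ?case
      using dual_step_unique[OF step[OF xs k], of "X ys (ys ! k)" "Y ys (Suc k)" m]
        step[OF ys k] nth \<gamma> d colA Y_carrier[OF xs, of k] k by simp
  qed
  \<comment> \<open>An item is a copy \<open>(j, l)\<close> with the data of column
    \<open>j\<close>. Primal values are stored by copy but indexed by time in the locale, hence the
    lookup at \<open>xs ! k\<close>.\<close>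
  interpret online_lp S m "\<lambda>p. c $ fst p" "\<lambda>p i. col A (fst p) $ i" "\<lambda>i. d $ i"
    \<gamma> abar cbar dlow dbar R "\<lambda>xs k i. Y xs k $ i" "\<lambda>xs k. X xs (xs ! k)"
  proof unfold_locales
    show "\<bar>col A (fst p) $ i\<bar> \<le> abar" if "p \<in> S" "i < m" for p i
      using A2 that by (auto simp: assm_A2_def S_def)
    show "\<bar>c $ fst p\<bar> \<le> cbar" if "p \<in> S" for p
      using A2 that by (auto simp: assm_A2_def S_def)
    show "Y xs (Suc k) $ i = max 0 (Y xs k $ i - \<gamma> * (d $ i - X xs (xs ! k) * col A (fst (xs ! k)) $ i))"
      if "xs \<in> permutations_of_set S" "k < card S" "i < m" for xs k i
      using proj(4) that by simp
    show "0 \<le> X xs (xs ! k) \<and> X xs (xs ! k) \<le> 1"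
      if "xs \<in> permutations_of_set S" "k < card S" for xs k
      using proj(2,3) that by simp
    show "\<exists>w\<in>{($) (Y xs k), ($) (Y xs (Suc k))}.
        X xs (xs ! k) * (c $ fst (xs ! k) - (\<Sum>i<m. col A (fst (xs ! k)) $ i * w i))
        = max 0 (c $ fst (xs ! k) - (\<Sum>i<m. col A (fst (xs ! k)) $ i * w i))"
      if "xs \<in> permutations_of_set S" "k < card S" for xs k
      using proj(5)[OF that that(1)] that by (cases upd) (auto simp: Let_def)
    show "L2_set (($) (Y xs 0)) {..<m} \<le> R" if "xs \<in> permutations_of_set S" for xs
      using Y0[OF that] y1 by (simp add: l2norm_def)
    show "Y xs k $ i = Y ys k $ i"
      if "xs \<in> permutations_of_set S" "ys \<in> permutations_of_set S" "k \<le> card S" "take k xs = take k ys"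
      for xs ys k i
      by (simp only: past[OF that])
  qed (use S \<gamma> dlow R abar dbar d_bound in auto)
  have G: "G = g" and B: "B = \<beta>"
    by (simp_all add: G_def B_def g_def \<beta>_def)
  define P where "P = permutations_of_set S"
  define p where "p = real (card P)"
  have P: "finite P" "P \<noteq> {}" using S(1) by (auto simp: P_def)
  then have p: "p > 0" by (simp add: p_def card_gt_0_iff)
  have expectation: "order_expectation n K f = (\<Sum>xs\<in>P. f xs) / p" for f
    using P by (simp add: S(4) P_def[symmetric] integral_pmf_of_set p_def)
  have used: "(\<Sum>k<card S. w (fst (xs ! k)) * X xs (xs ! k)) = K * (\<Sum>j<n. w j * xhat xs $ j)"
    if "xs \<in> P" for xs w
    using sum_order_copies[of xs n K w "X xs"] that size xhat[of xs] by (simp add: S(3,4) P_def)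
  have total: "(\<Sum>k<card S. w (fst (xs ! k))) = K * (\<Sum>j<n. w j)" if "xs \<in> P" for xs and w :: "nat \<Rightarrow> real"
    using sum_order_copies[of xs n K w "\<lambda>_. 1"] that size by (simp add: S(3,4) P_def)
  have xhat_carrier: "xhat xs \<in> carrier_vec n" if "xs \<in> P" for xs
    using xhat[of xs] that by (simp add: P_def)
  have Ax: "(A *\<^sub>v x) $ i = (\<Sum>j<n. col A j $ i * x $ j)" if "x \<in> carrier_vec n" "i < m" for x i
    using that A by (simp add: scalar_prod_lessThan[of _ n])

  show ?gap
  proof -
    define bd where "bd = 2 * cbar + R\<^sup>2 / \<gamma> + 3 * \<gamma> * (n * K) * m * g\<^sup>2 + 4 * abar * \<beta> * sqrt (n * K * m)"
    \<comment> \<open>Proved for each feasible \<open>x\<close> separately, which then bounds the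
      supremum. Every copy of column \<open>j\<close> is compared with the value
      \<open>x $ j\<close>.\<close>
    have "c \<bullet> x \<le> (\<Sum>xs\<in>P. c \<bullet> xhat xs) / p + bd / K" if x: "x \<in> feasible A b" for x
    proof -
      have xc: "x \<in> carrier_vec n" and Axb: "A *\<^sub>v x \<le> b" and x01: "\<And>j. j < n \<Longrightarrow> 0 \<le> x $ j \<and> x $ j \<le> 1"
        using x dimA by (auto simp: feasible_def)
      have "(\<Sum>xs\<in>P. \<Sum>k<card S. c $ fst (xs ! k) * (x $ fst (xs ! k) - X xs (xs ! k))) \<le> p * bd"
        unfolding P_def p_def bd_def G[symmetric] B[symmetric] S(3)[symmetric]
      proof (rule expected_regret)
        show "0 \<le> x $ fst j \<and> x $ fst j \<le> 1" if "j \<in> S" for j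
          using x01 that by (auto simp: S_def)
        fix i assume i: "i < m"
        have "(\<Sum>j\<in>S. col A (fst j) $ i * x $ fst j) = K * (A *\<^sub>v x) $ i"
          using Ax[OF xc i] by (simp add: S_def sum.cartesian_product' sum_distrib_left)
        also have "\<dots> \<le> K * b $ i"
          using Axb b i by (intro mult_left_mono) (auto simp: less_eq_vec_def)
        also have "\<dots> = card S * d $ i"
          using size d_nth[OF i] by (simp add: S(3))
        finally show "(\<Sum>j\<in>S. col A (fst j) $ i * x $ fst j) \<le> card S * d $ i" .
      qed
      moreover have "(\<Sum>k<card S. c $ fst (xs ! k) * (x $ fst (xs ! k) - X xs (xs ! k)))
          = K * (c \<bullet> x - c \<bullet> xhat xs)" if xs: "xs \<in> P" for xs
        using total[OF xs, of "\<lambda>j. c $ j * x $ j"] used[OF xs, of "\<lambda>j. c $ j"]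
        by (simp add: right_diff_distrib sum_subtractf scalar_prod_lessThan[OF xc]
            scalar_prod_lessThan[OF xhat_carrier[OF xs]])
      ultimately have "(\<Sum>xs\<in>P. K * (c \<bullet> x - c \<bullet> xhat xs)) \<le> p * bd" by simp
      then have "K * (p * (c \<bullet> x) - (\<Sum>xs\<in>P. c \<bullet> xhat xs)) \<le> p * bd"
        by (simp add: sum_distrib_left[symmetric] sum_subtractf p_def)
      then show ?thesis using p size by (simp add: field_simps)
    qed
    moreover have "0\<^sub>v n \<in> feasible A b"
    proof -
      have "b $ i \<ge> 0" if "i < m" for i
      proof -
        have "0 \<le> b $ i / n" using d_bound[OF that] d_nth[OF that] dlow by linarith
        then show ?thesis using size by (simp add: zero_le_divide_iff)
      qed
      then show ?thesis using A b by (auto simp: feasible_def less_eq_vec_def)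
    qed
    ultimately have "(SUP x\<in>feasible A b. c \<bullet> x) \<le> (\<Sum>xs\<in>P. c \<bullet> xhat xs) / p + bd / K"
      by (intro cSUP_least) auto
    moreover have "order_expectation n K (\<lambda>xs. opt_gap A b c (xhat xs))
        = (SUP x\<in>feasible A b. c \<bullet> x) - (\<Sum>xs\<in>P. c \<bullet> xhat xs) / p"
      unfolding expectation opt_gap_def using p
      by (simp add: sum_subtractf p_def diff_divide_distrib)
    ultimately show ?thesis unfolding bd_def by linarith
  qed

  show ?viol
  proof -
    \<comment> \<open>This bound holds for every order, so averaging is immediate.\<close>
    have "violation A b (xhat xs) \<le> 2 * \<beta> / (\<gamma> * K)" if xs: "xs \<in> P" for xs
    proof -
      have xs': "xs \<in> permutations_of_set S" using xs by (simp add: P_def)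
      define r where "r = 1 / (\<gamma> * K)"
      have r: "r \<ge> 0" using \<gamma> by (simp add: r_def)
      have le: "pos_part (A *\<^sub>v xhat xs - b) $ i \<le> r * (\<bar>Y xs (card S) $ i\<bar> + \<bar>Y xs 0 $ i\<bar>)"
        if i: "i < m" for i
      proof -
        have "K * ((A *\<^sub>v xhat xs) $ i - b $ i)
            = (\<Sum>k<card S. X xs (xs ! k) * col A (fst (xs ! k)) $ i - d $ i)"
          using used[OF xs, of "\<lambda>j. col A j $ i"] Ax[OF xhat_carrier[OF xs] i] d_nth[OF i] size
          by (simp add: sum_subtractf S(3) mult.commute right_diff_distrib)
        also have "\<dots> \<le> (Y xs (card S) $ i - Y xs 0 $ i) / \<gamma>"
          by (rule usage_le[OF xs' i])
        also have "\<dots> \<le> (\<bar>Y xs (card S) $ i\<bar> + \<bar>Y xs 0 $ i\<bar>) / \<gamma>"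
          using \<gamma> by (intro divide_right_mono) auto
        finally have "(A *\<^sub>v xhat xs) $ i - b $ i \<le> r * (\<bar>Y xs (card S) $ i\<bar> + \<bar>Y xs 0 $ i\<bar>)"
          using size \<gamma> by (simp add: r_def field_simps)
        \<comment> \<open>The right-hand side is nonnegative, so the positive part is bounded as
          well.\<close>
        then show ?thesis
          using r b i A by (simp add: pos_part_def)
      qed
      have "violation A b (xhat xs) \<le> L2_set (\<lambda>i. r * (\<bar>Y xs (card S) $ i\<bar> + \<bar>Y xs 0 $ i\<bar>)) {..<m}"
        unfolding violation_def l2norm_def
        using b le by (auto intro!: L2_set_mono simp: pos_part_def)
      also have "\<dots> = r * L2_set (\<lambda>i. \<bar>Y xs (card S) $ i\<bar> + \<bar>Y xs 0 $ i\<bar>) {..<m}"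
        by (rule L2_set_right_distrib[OF r, symmetric])
      also have "\<dots> \<le> r * (L2_set (\<lambda>i. \<bar>Y xs (card S) $ i\<bar>) {..<m} + L2_set (\<lambda>i. \<bar>Y xs 0 $ i\<bar>) {..<m})"
        by (rule mult_left_mono[OF L2_set_triangle_ineq r])
      also have "\<dots> \<le> r * (\<beta> + \<beta>)"
        using norm_bound[OF xs', of "card S"] norm_bound[OF xs', of 0] B r
        by (intro mult_left_mono add_mono) (auto simp: L2_set_def)
      finally show ?thesis by (simp add: r_def)
    qed
    then have "(\<Sum>xs\<in>P. violation A b (xhat xs)) \<le> (\<Sum>xs\<in>P. 2 * \<beta> / (\<gamma> * K))"
      by (rule sum_mono)
    then show ?thesis unfolding expectation using p by (simp add: p_def field_simps)
  qed
qed

section \<open>Rates for the prescribed stepsize\<close>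

text \<open>With \<open>s = sqrt (K * m * n)\<close> and \<open>\<sigma> = s / K\<close>, the
  stepsize is of order \<open>1 / s\<close>. Then \<open>1 / (\<gamma> * K)\<close> and
  \<open>\<gamma> * n * m\<close> are \<open>O(\<sigma>)\<close>, while
  \<open>\<gamma> * m * \<sigma>\<close> is \<open>O(m / K)\<close>; these are the only quantities
  in the explicit bounds besides \<open>1 / K\<close>, \<open>\<sigma>\<close> and
  constants.\<close>

theorem theorem3:
  fixes abar cbar dlow dbar \<kappa>1 \<kappa>2 \<kappa>3 R :: real
  assumes "\<kappa>1 > 0" and "\<kappa>2 > 0"
  shows "\<exists>C>0. \<forall>(upd :: update) (m :: nat) (n :: nat) (K :: nat) (A :: real mat)
      (b :: real vec) (c :: real vec) (\<gamma> :: real) (y1 :: real vec)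
      (xhat :: (nat \<times> nat) list \<Rightarrow> real vec).
    m \<ge> 1 \<and> n \<ge> 2 \<and> K \<ge> 1 \<and>
    A \<in> carrier_mat m n \<and> b \<in> carrier_vec m \<and> c \<in> carrier_vec n \<and>
    assm_A1 m n b dlow dbar \<and> assm_A2 m n A c abar cbar \<and> assm_A3 m n A c \<and>
    real K \<le> \<kappa>3 * real n \<and>
    \<kappa>1 / sqrt (real K * real m * real n) \<le> \<gamma> \<and> \<gamma> \<le> \<kappa>2 / sqrt (real K * real m * real n) \<and>
    y1 \<in> carrier_vec m \<and> l2norm y1 \<le> R \<and>
    (\<forall>ord\<in>orders n K. dup_output upd A b c K \<gamma> y1 ord (xhat ord))
    \<longrightarrow>
    order_expectation n K (\<lambda>ord. opt_gap A b c (xhat ord))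
      \<le> C * (real m * ln (real n) / real K + sqrt (real n / real K) * ln (real n)
              + sqrt (real m * real n / real K)) \<and>
    order_expectation n K (\<lambda>ord. violation A b (xhat ord))
      \<le> C * (real m / real K + sqrt (real m * real n / real K))"
proof (cases "abar > 0 \<and> cbar > 0 \<and> dlow > 0 \<and> dbar > 0 \<and> R \<ge> 0")
  \<comment> \<open>The hypotheses force these signs, so otherwise the claim is vacuous and any
    positive constant will do.\<close>
  case False
  have "abar > 0 \<and> cbar > 0 \<and> dlow > 0 \<and> dbar > 0 \<and> R \<ge> 0"
    if "m \<ge> 1" "assm_A1 m n b dlow dbar" "assm_A2 m n A c abar cbar" "l2norm y1 \<le> R"
    for m n A b c and y1 :: "real vec"
  proof -
    have "Min ((\<lambda>i. scaled_rhs n b $ i) ` {..<m}) \<le> Max ((\<lambda>i. scaled_rhs n b $ i) ` {..<m})"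
      using that(1) by (intro order_trans[OF Min_le[of _ "scaled_rhs n b $ 0"] Max_ge]) auto
    then show ?thesis
      using that by (auto simp: assm_A1_def assm_A2_def l2norm_def intro: order_trans[OF L2_set_nonneg])
  qed
  then show ?thesis using False by (intro exI[of _ 1]) (auto, blast+)
next
  case True
  define g where "g = abar + dbar"
  define B0 B1 where "B0 = R + cbar / dlow" and "B1 = 3 * g\<^sup>2 / dlow + g"
  \<comment> \<open>\<open>C1\<close> and \<open>C3\<close> collect the coefficients of
    \<open>\<sigma>\<close> in the gap and in the violation, \<open>C2\<close> and \<open>C4\<close>
    those of \<open>m / K\<close>. The \<open>ln 2\<close> in \<open>C2\<close> prepares the passage
    from \<open>m / K\<close> to \<open>m * ln n / K\<close>.\<close>
  define C1 C2 C3 C4 where "C1 = R\<^sup>2 / \<kappa>1 + 3 * g\<^sup>2 * \<kappa>2 + 4 * abar * B0"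
    and "C2 = (2 * cbar + 4 * abar * B1 * \<kappa>2) / ln 2"
    and "C3 = 2 * B0 / \<kappa>1" and "C4 = 2 * B1 * \<kappa>2 / \<kappa>1"
  define C where "C = 1 + C1 + C2 + C3 + C4"
  have B01: "B0 \<ge> 0" "B1 \<ge> 0" using True by (auto simp: B0_def B1_def g_def)
  have Cs: "C1 \<ge> 0" "C2 \<ge> 0" "C3 \<ge> 0" "C4 \<ge> 0"
    using True B01 assms by (auto simp: C1_def C2_def C3_def C4_def)
  show ?thesis
  proof (intro exI[of _ C] conjI allI impI; (elim conjE)?)
    show "C > 0" using Cs by (simp add: C_def)
  next
    fix upd :: update and m n K :: nat and A :: "real mat" and b c y1 :: "real vec" and \<gamma> :: real
      and xhat :: "(nat \<times> nat) list \<Rightarrow> real vec"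
    assume size: "1 \<le> m" "2 \<le> n" "1 \<le> K"
      and dims: "A \<in> carrier_mat m n" "b \<in> carrier_vec m" "c \<in> carrier_vec n"
      and A12: "assm_A1 m n b dlow dbar" "assm_A2 m n A c abar cbar"
      and \<gamma>: "\<kappa>1 / sqrt (real K * real m * real n) \<le> \<gamma>" "\<gamma> \<le> \<kappa>2 / sqrt (real K * real m * real n)"
      and y1: "y1 \<in> carrier_vec m" "l2norm y1 \<le> R"
      and out: "\<forall>ord\<in>orders n K. dup_output upd A b c K \<gamma> y1 ord (xhat ord)"
    define s where "s = sqrt (real K * real m * real n)"
    define \<sigma> where "\<sigma> = s / K"
    have s: "s > 0" "s * s = real K * real m * real n" using size by (auto simp: s_def)
    have "0 < \<kappa>1 / s" using assms(1) s(1) by simp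
    also have "\<dots> \<le> \<gamma>" using \<gamma>(1) by (simp add: s_def)
    finally have \<gamma>_pos: "\<gamma> > 0" .
    have \<sigma>: "\<sigma> = sqrt (real m * real n / real K)"
    proof (rule real_sqrt_unique[symmetric])
      show "\<sigma>\<^sup>2 = real m * real n / real K"
        using s(2) size by (simp add: \<sigma>_def power2_eq_square)
    qed (use s(1) in \<open>simp add: \<sigma>_def\<close>)
    have \<sigma>_pos: "\<sigma> > 0" using s size by (simp add: \<sigma>_def)
    have \<gamma>s: "\<gamma> * s \<le> \<kappa>2" "\<kappa>1 \<le> \<gamma> * s"
      using \<gamma> s(1) unfolding s_def[symmetric] by (simp_all add: field_simps)
    have u1: "1 / (\<gamma> * K) \<le> \<sigma> / \<kappa>1"
      using \<gamma>s(2) \<gamma>_pos assms(1) size by (simp add: \<sigma>_def field_simps)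
    have "\<gamma> * n * m = (\<gamma> * s) * \<sigma>"
      using s(2) size by (simp add: \<sigma>_def field_simps)
    also have "\<dots> \<le> \<kappa>2 * \<sigma>" using \<gamma>s(1) \<sigma>_pos by simp
    finally have u2: "\<gamma> * n * m \<le> \<kappa>2 * \<sigma>" .
    have "\<gamma> * m * \<sigma> = (\<gamma> * s) * (m / K)" by (simp add: \<sigma>_def)
    also have "\<dots> \<le> \<kappa>2 * (m / K)" using \<gamma>s(1) by (rule mult_right_mono) simp
    finally have u3: "\<gamma> * m * \<sigma> \<le> \<kappa>2 * (m / K)" .
    define \<beta> where "\<beta> = R + (cbar + 3 * \<gamma> * m * g\<^sup>2) / dlow + \<gamma> * m * g"
    \<comment> \<open>The dual bound is affine in \<open>\<gamma> * m\<close>, so its product with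
      \<open>\<sigma>\<close> splits into a multiple of \<open>\<sigma>\<close> and, through
      \<open>u3\<close>, one of \<open>m / K\<close>.\<close>
    have "\<beta> = B0 + B1 * (\<gamma> * m)"
      by (simp add: \<beta>_def B0_def B1_def add_divide_distrib algebra_simps)
    then have "\<beta> * \<sigma> = B0 * \<sigma> + B1 * (\<gamma> * m * \<sigma>)" by (simp add: algebra_simps)
    also have "\<dots> \<le> B0 * \<sigma> + B1 * (\<kappa>2 * (m / K))"
      using u3 B01 by (intro add_left_mono mult_left_mono)
    finally have \<beta>: "\<beta> * \<sigma> \<le> B0 * \<sigma> + B1 * (\<kappa>2 * (m / K))" .
    have \<beta>_nonneg: "\<beta> \<ge> 0"
      using True \<gamma>_pos unfolding \<beta>_def g_def by (intro add_nonneg_nonneg divide_nonneg_nonneg) auto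
    note bounds = duplicated_lp_bounds[OF size(1) _ size(3) dims A12 \<gamma>_pos y1 out[rule_format],
        folded g_def, folded \<beta>_def]
    have root: "sqrt (real (n * K * m)) = K * \<sigma>"
      using size by (simp add: \<sigma>_def s_def mult_ac)
    have "order_expectation n K (\<lambda>ord. opt_gap A b c (xhat ord))
      \<le> (2 * cbar + R\<^sup>2 / \<gamma> + 3 * \<gamma> * (n * K) * m * g\<^sup>2 + 4 * abar * \<beta> * (K * \<sigma>)) / K"
      using bounds(1) size(2) unfolding root by simp
    also have "\<dots> = 2 * cbar * (1 / K) + R\<^sup>2 * (1 / (\<gamma> * K)) + 3 * g\<^sup>2 * (\<gamma> * n * m) + 4 * abar * (\<beta> * \<sigma>)"
      using size by (simp add: add_divide_distrib algebra_simps)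
    also have "\<dots> \<le> 2 * cbar * (m / K) + R\<^sup>2 * (\<sigma> / \<kappa>1) + 3 * g\<^sup>2 * (\<kappa>2 * \<sigma>)
        + 4 * abar * (B0 * \<sigma> + B1 * (\<kappa>2 * (m / K)))"
      using True u1 u2 \<beta> size by (intro add_mono mult_left_mono) (auto simp: divide_right_mono)
    also have "\<dots> = C1 * \<sigma> + C2 * (m * ln 2 / K)"
      by (simp add: C1_def C2_def algebra_simps add_divide_distrib)
    also have "\<dots> \<le> C * \<sigma> + C * (m * ln n / K) + C * (sqrt (n / K) * ln n)"
    proof -
      have "C1 * \<sigma> \<le> C * \<sigma>" using Cs \<sigma>_pos by (intro mult_right_mono) (auto simp: C_def)
      \<comment> \<open>Here \<open>n >= 2\<close> enters, as \<open>ln 2 <= ln n\<close>.\<close>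
      moreover have "C2 * (m * ln 2 / K) \<le> C * (m * ln n / K)"
        using Cs size by (intro mult_mono divide_right_mono mult_left_mono) (auto simp: C_def)
      moreover have "0 \<le> C * (sqrt (n / K) * ln n)" using Cs size by (simp add: C_def)
      ultimately show ?thesis by linarith
    qed
    also have "\<dots> = C * (real m * ln (real n) / real K + sqrt (real n / real K) * ln (real n)
              + sqrt (real m * real n / real K))"
      by (simp add: \<sigma>[symmetric] algebra_simps)
    finally show "order_expectation n K (\<lambda>ord. opt_gap A b c (xhat ord))
      \<le> C * (real m * ln (real n) / real K + sqrt (real n / real K) * ln (real n)
              + sqrt (real m * real n / real K))" .
    have "order_expectation n K (\<lambda>ord. violation A b (xhat ord)) \<le> 2 * \<beta> * (1 / (\<gamma> * K))"
      using bounds(2) size(2) by simp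
    also have "\<dots> \<le> 2 * \<beta> * (\<sigma> / \<kappa>1)" using u1 \<beta>_nonneg by (intro mult_left_mono) auto
    also have "\<dots> = 2 / \<kappa>1 * (\<beta> * \<sigma>)" by simp
    also have "\<dots> \<le> 2 / \<kappa>1 * (B0 * \<sigma> + B1 * (\<kappa>2 * (m / K)))"
      using assms(1) by (intro mult_left_mono \<beta>) auto
    also have "\<dots> = C4 * (m / K) + C3 * \<sigma>"
      by (simp add: C3_def C4_def algebra_simps)
    also have "\<dots> \<le> C * (m / K) + C * \<sigma>"
      using Cs \<sigma>_pos by (intro add_mono mult_right_mono) (auto simp: C_def)
    finally show "order_expectation n K (\<lambda>ord. violation A b (xhat ord))
      \<le> C * (real m / real K + sqrt (real m * real n / real K))"
      by (simp add: \<sigma>[symmetric] algebra_simps)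
  qed
qed

end
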